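(* For every positive integer $t$ there exist constants $0 < n_1 < \cdots < n_t$ (integers) and $0 < \lambda_t < 1/6$, $t$ triple systems $\mathcal{G}_1,\ldots,\mathcal{G}_t$ with $v(\mathcal{G}_i) = n_i$ for $i\in[t]$, and a finite family $\mathcal{M}_t$ of triple systems with the following properties. (a) The inequality $\mathrm{ex}(n,\mathcal{M}_t) \le \lambda_t n^3$ holds for all positive integers $n$, and moreover, equality holds whenever $n$ is a multiple of $n_i$ for some $i\in[t]$. (b) For every $\delta > 0$ there exist $\epsilon>0$ and $N_0$ such that the following holds for all $n \ge N_0$. Every $\mathcal{M}_t$-free triple system $\mathcal{H}$ on $n$ vertices with at least $(\lambda_t-\epsilon)n^3$ edges can be made $\mathcal{G}_i$-colorable for some $i\in[t]$ by removing at most $\delta n$ vertices. Moreover, $\xi(\mathcal{M}_t) = t$.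
   Context: An $r$-graph is an $r$-uniform hypergraph on a finite vertex set; it is identified with its edge set, so $|\mathcal{H}|$ is the number of edges, $V(\mathcal{H})$ is the vertex set and $v(\mathcal{H})=|V(\mathcal{H})|$. A triple system is a $3$-graph. $[t]=\{1,\dots,t\}$. For a family $\mathcal{F}$ of $r$-graphs, an $r$-graph is $\mathcal{F}$-free if it contains no member of $\mathcal{F}$ as a (not necessarily induced) subgraph. $\mathrm{ex}(n,\mathcal{F})$ is the maximum number of edges of an $\mathcal{F}$-free $r$-graph on $n$ vertices. $\mathcal{H}$ is $\mathcal{G}$-colorable if there exists a map $\phi\colon V(\mathcal{H})\to V(\mathcal{G})$ such that $\phi(E)\in\mathcal{G}$ for all $E\in\mathcal{H}$. Stability number: a family $\mathcal{F}$ of $r$-graphs is $t$-stable if for every $m\in\mathbb{N}$ there exist $r$-graphs $\mathcal{G}_1(m),\ldots,\mathcal{G}_t(m)$ on $m$ vertices such that the following holds: for every $\delta>0$ there exist $\epsilon>0$ and $n_0$ such that for all $n\ge n_0$, if $\mathcal{H}$ is an $\mathcal{F}$-free $r$-graph on $n$ vertices with $|\mathcal{H}|>(1-\epsilon)\,\mathrm{ex}(n,\mathcal{F})$, then $\mathcal{H}$ can be transformed into (an isomorphic copy of) some $\mathcal{G}_i(n)$ by adding and removing at most $\delta|\mathcal{H}|$ edges. $\xi(\mathcal{F})$ is the minimum integer $t$ such that $\mathcal{F}$ is $t$-stable, and $\xi(\mathcal{F})=\infty$ if there is no such $t$. *)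

theory Defs
  imports Complex_Main "HOL-Library.Extended_Nat"
begin

record 'a hypergraph =
  verts :: "'a set"
  edges :: "'a set set"

definition rgraph :: "nat \<Rightarrow> 'a hypergraph \<Rightarrow> bool" where
  "rgraph r H \<longleftrightarrow> finite (verts H) \<and> (\<forall>e\<in>edges H. e \<subseteq> verts H \<and> card e = r)"

definition contains :: "'a hypergraph \<Rightarrow> 'b hypergraph \<Rightarrow> bool" where
  "contains H F \<longleftrightarrow>
     (\<exists>f. inj_on f (verts F) \<and> f ` verts F \<subseteq> verts H \<and> (\<forall>e\<in>edges F. f ` e \<in> edges H))"

definition free :: "'b hypergraph set \<Rightarrow> 'a hypergraph \<Rightarrow> bool" where
  "free \<F> H \<longleftrightarrow> (\<forall>F\<in>\<F>. \<not> contains H F)"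

text \<open>Every finite hypergraph has an isomorphic copy with vertices in \<open>nat\<close>, so it suffices
  to quantify over hypergraphs on finite sets of natural numbers, here and below.\<close>

definition ex_num :: "nat \<Rightarrow> nat \<Rightarrow> nat hypergraph set \<Rightarrow> nat" where
  "ex_num r n \<F> =
     Max {card (edges H) | H :: nat hypergraph. rgraph r H \<and> card (verts H) = n \<and> free \<F> H}"

definition colorable :: "'b hypergraph \<Rightarrow> 'a hypergraph \<Rightarrow> bool" where
  "colorable G H \<longleftrightarrow> (\<exists>\<phi>. \<phi> ` verts H \<subseteq> verts G \<and> (\<forall>e\<in>edges H. \<phi> ` e \<in> edges G))"

definition remove_verts :: "'a hypergraph \<Rightarrow> 'a set \<Rightarrow> 'a hypergraph" where
  "remove_verts H S = \<lparr>verts = verts H - S, edges = {e \<in> edges H. e \<inter> S = {}}\<rparr>"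

definition isomorphic :: "'a hypergraph \<Rightarrow> 'b hypergraph \<Rightarrow> bool" where
  "isomorphic G H \<longleftrightarrow>
     (\<exists>f. bij_betw f (verts G) (verts H) \<and> edges H = (\<lambda>e. f ` e) ` edges G)"

text \<open>\<open>H\<close> becomes an isomorphic copy of \<open>G\<close> (on the same vertex set as \<open>H\<close>) by adding and
  removing at most \<open>k\<close> edges in total.\<close>

definition transformable :: "real \<Rightarrow> 'a hypergraph \<Rightarrow> 'b hypergraph \<Rightarrow> bool" where
  "transformable k H G \<longleftrightarrow>
     (\<exists>G' :: 'a hypergraph. verts G' = verts H \<and> isomorphic G G' \<and>
        real (card ((edges G' - edges H) \<union> (edges H - edges G'))) \<le> k)"

definition t_stable :: "nat \<Rightarrow> nat hypergraph set \<Rightarrow> nat \<Rightarrow> bool" where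
  "t_stable r \<F> t \<longleftrightarrow>
     (\<exists>G :: nat \<Rightarrow> nat \<Rightarrow> nat hypergraph.
        (\<forall>m. \<forall>i\<in>{1..t}. rgraph r (G i m) \<and> card (verts (G i m)) = m) \<and>
        (\<forall>\<delta>::real. \<delta> > 0 \<longrightarrow>
           (\<exists>\<epsilon>::real. \<epsilon> > 0 \<and>
              (\<exists>n\<^sub>0. \<forall>n\<ge>n\<^sub>0. \<forall>H :: nat hypergraph.
                 rgraph r H \<and> card (verts H) = n \<and> free \<F> H \<and>
                 real (card (edges H)) > (1 - \<epsilon>) * real (ex_num r n \<F>) \<longrightarrow>
                 (\<exists>i\<in>{1..t}. transformable (\<delta> * real (card (edges H))) H (G i n))))))"

text \<open>The infimum of the empty set in \<open>enat\<close> is \<open>\<infinity>\<close>.\<close>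

definition stability_number :: "nat \<Rightarrow> nat hypergraph set \<Rightarrow> enat" where
  "stability_number r \<F> = Inf {enat t | t. t_stable r \<F> t}"

end

theory Submission
  imports Defs "HOL-Library.FuncSet"
begin

text \<open>
  The weight of a triple system \<open>H\<close> under a vertex weighting \<open>w\<close> is the sum of \<open>w x * w y * w z\<close>
  over its edges. With the uniform weighting on \<open>k\<close> vertices it is the number of edges divided by
  \<open>k\<^sup>3\<close>, and the weight of a blow-up is the weight of the blown-up system under the vector of class
  weights. So a system \<open>G\<close> whose weight, over all probability vectors, has the maximum \<open>lam\<close> confines
  the \<open>G\<close>-colourable systems to at most \<open>lam * k\<^sup>3\<close> edges.

  The patterns. Remove from the complete triple system on \<open>n\<close> vertices a sparse system in which every
  vertex has the same degree \<open>d\<close>. The uniform vector remains the only maximiser, with a quadratic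
  loss away from it (\<open>pattern_complement\<close>). The maximum depends only on \<open>n\<close> and \<open>d\<close>, and for
  \<open>n = 6 * s * (s + i)\<close> and \<open>d = 1 + 9 * i * (s + i)\<close> it equals \<open>1/6 - 1 / (12 * s\<^sup>2)\<close> whatever \<open>i\<close>
  is (\<open>pattern_circulant\<close>). Any two vertices of a pattern lie in a common edge, so homomorphisms
  between patterns are injective; uniqueness of the maximiser then excludes homomorphisms between
  patterns of different sizes (\<open>pattern_hom\<close>).

  The forbidden family consists of all triple systems on boundedly many vertices that no pattern
  colours. A system avoiding it is locally colourable: every bounded set of vertices spans a
  colourable subsystem. The upper bound follows by symmetrisation: as long as two vertices of the
  support of a weighting lie in no common edge, all the weight of one of them
  can be moved to the other without loss. In the end any two vertices of the support are covered by an edge; local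
  colourability forces such a support to be small, hence colourable, so that the weight is at most
  \<open>lam\<close> (\<open>wt_le_lam\<close>).

  For stability (\<open>core_colourable\<close>) the moves are undone one at a time, while a colouring of all
  vertices with almost maximal derivative is maintained. The key is \<open>extend_colouring\<close>: if, under
  a weighting for which the system has almost maximal weight, all but
  a small part of the weight is coloured, and the coloured vertices have almost maximal derivative,
  then the colouring extends to any further vertex \<open>z\<close>.
  Otherwise each colour is excluded for \<open>z\<close> by one edge; these edges, together with a suitable copy
  of the pattern, span a bounded set on which the copy determines all colours, contradicting local
  colourability. Under the uniform weighting the vertices with small derivative are few, which gives
  stability after removing vertices. Since class sizes are almost equal by the quadratic
  loss, it also gives closeness to a balanced blow-up in edit distance (\<open>balanced_stable\<close>).
  The balanced blow-ups of distinct patterns are far apart, as a copy of the first pattern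
  survives a small number of edits and cannot be coloured by the second (\<open>balanced_far_apart\<close>); so
  fewer than \<open>t\<close> approximate shapes do not suffice.
\<close>

section \<open>Weights of set systems\<close>

lemma sum_le_sum_cover:
  fixes f :: "'a \<Rightarrow> real"
  assumes "finite I" "\<And>i. i \<in> I \<Longrightarrow> finite (A i)" "S \<subseteq> (\<Union>i\<in>I. A i)"
    and "\<And>i x. i \<in> I \<Longrightarrow> x \<in> A i \<Longrightarrow> 0 \<le> f x"
  shows "sum f S \<le> (\<Sum>i\<in>I. sum f (A i))"
proof -
  have "sum f S \<le> (\<Sum>p\<in>Sigma I A. f (snd p))"
    by (rule sum_le_included[where i = snd])
      (use assms in \<open>force intro: finite_subset[OF assms(3)]\<close>)+
  also have "\<dots> = (\<Sum>i\<in>I. sum f (A i))"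
    using assms by (simp add: sum.Sigma split_def)
  finally show ?thesis .
qed

definition wt :: "'a set set \<Rightarrow> ('a \<Rightarrow> real) \<Rightarrow> real" where
  "wt E w = (\<Sum>e\<in>E. \<Prod>x\<in>e. w x)"

definition link :: "'a \<Rightarrow> 'a set set \<Rightarrow> 'a set set" where
  "link v E = (\<lambda>e. e - {v}) ` {e \<in> E. v \<in> e}"

definition uniform :: "nat \<Rightarrow> 'a set \<Rightarrow> 'a set set \<Rightarrow> bool" where
  "uniform r V E \<longleftrightarrow> finite V \<and> (\<forall>e\<in>E. e \<subseteq> V \<and> card e = r)"

text \<open>Mass at most 1, rather than exactly 1, so that restrictions to subsets are again of this
  kind.\<close>

definition subweight :: "'a set \<Rightarrow> ('a \<Rightarrow> real) \<Rightarrow> bool" where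
  "subweight V w \<longleftrightarrow> (\<forall>x\<in>V. 0 \<le> w x) \<and> sum w V \<le> 1"

lemma uniformD:
  assumes "uniform r V E"
  shows "finite V" "finite E" "e \<in> E \<Longrightarrow> e \<subseteq> V" "e \<in> E \<Longrightarrow> card e = r" "e \<in> E \<Longrightarrow> finite e"
proof -
  have "E \<subseteq> Pow V" "finite V" using assms unfolding uniform_def by auto
  then show "finite V" "finite E" by (auto intro: finite_subset)
qed (use assms in \<open>auto simp: uniform_def intro: finite_subset\<close>)

lemma uniform_subset: "uniform r V E \<Longrightarrow> E' \<subseteq> E \<Longrightarrow> uniform r V E'"
  unfolding uniform_def by blast

lemma uniform_link: "uniform (Suc r) V E \<Longrightarrow> uniform r V (link v E)"
  unfolding uniform_def link_def by (auto simp: card_Diff_singleton)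

lemma link_mono: "E' \<subseteq> E \<Longrightarrow> link v E' \<subseteq> link v E"
  unfolding link_def by auto

lemma link_Diff: "link v (E - E') = link v E - link v E'"
proof -
  have eq: "{e \<in> E - E'. v \<in> e} = {e \<in> E. v \<in> e} - {e \<in> E'. v \<in> e}" by blast
  have "inj_on (\<lambda>e. e - {v}) {e. v \<in> e}" by (rule inj_onI) auto
  then show ?thesis
    unfolding link_def eq by (rule inj_on_image_set_diff) auto
qed

lemma subweightD:
  assumes "subweight V w"
  shows "x \<in> V \<Longrightarrow> 0 \<le> w x" "sum w V \<le> 1"
  using assms unfolding subweight_def by auto

lemma subweight_subset: "subweight V w \<Longrightarrow> finite V \<Longrightarrow> R \<subseteq> V \<Longrightarrow> subweight R w"
  unfolding subweight_def by (meson Diff_iff order_trans subset_eq sum_mono2)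

lemma prod_nonneg_weight:
  assumes "uniform r V E" "subweight V w" "e \<in> E" "e' \<subseteq> e"
  shows "0 \<le> (\<Prod>x\<in>e'. w x)"
  using assms by (intro prod_nonneg) (auto dest: uniformD subweightD)

lemma wt_mono:
  assumes "uniform r V E" "subweight V w" "E' \<subseteq> E"
  shows "wt E' w \<le> wt E w"
  unfolding wt_def using assms
  by (intro sum_mono2) (auto dest: uniformD intro!: prod_nonneg_weight[where e' = e and e = e for e])

lemma wt_nonneg: "uniform r V E \<Longrightarrow> subweight V w \<Longrightarrow> 0 \<le> wt E w"
  using wt_mono[of r V E w "{}"] by (simp add: wt_def)

lemma wt_diff:
  assumes "finite E" "E' \<subseteq> E"
  shows "wt (E - E') w = wt E w - wt E' w"
  using assms by (simp add: wt_def sum_diff finite_subset)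

lemma wt_link: "wt (link v E) w = (\<Sum>e\<in>{e \<in> E. v \<in> e}. \<Prod>x\<in>e - {v}. w x)"
proof -
  have "inj_on (\<lambda>e. e - {v}) {e \<in> E. v \<in> e}" by (rule inj_onI) auto
  then show ?thesis by (simp add: wt_def link_def sum.reindex)
qed

lemma weight_times_link:
  assumes "uniform r V E"
  shows "w v * wt (link v E) w = (\<Sum>e\<in>{e \<in> E. v \<in> e}. \<Prod>x\<in>e. w x)"
  unfolding wt_link sum_distrib_left using uniformD(5)[OF assms]
  by (intro sum.cong) (auto simp: prod.remove)

text \<open>Euler's identity for a homogeneous polynomial, as \<^term>\<open>wt (link v E) w\<close> is the partial
  derivative of \<^term>\<open>wt E w\<close> in \<^term>\<open>w v\<close>.\<close>

lemma sum_weight_link: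
  assumes "uniform r V E"
  shows "(\<Sum>v\<in>V. w v * wt (link v E) w) = real r * wt E w"
proof -
  note fin = uniformD(1,2)[OF assms]
  have "(\<Sum>v\<in>V. w v * wt (link v E) w) = (\<Sum>v\<in>V. \<Sum>e\<in>{e \<in> E. v \<in> e}. \<Prod>x\<in>e. w x)"
    by (simp add: weight_times_link[OF assms])
  also have "\<dots> = (\<Sum>e\<in>E. \<Sum>v\<in>{v \<in> V. v \<in> e}. \<Prod>x\<in>e. w x)"
    by (rule sum.swap_restrict) (use fin in auto)
  also have "\<dots> = (\<Sum>e\<in>E. real r * (\<Prod>x\<in>e. w x))"
  proof (rule sum.cong)
    fix e assume "e \<in> E"
    then have "{v \<in> V. v \<in> e} = e" "card e = r" using uniformD[OF assms] by auto
    then show "(\<Sum>v\<in>{v \<in> V. v \<in> e}. \<Prod>x\<in>e. w x) = real r * (\<Prod>x\<in>e. w x)" by simp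
  qed simp
  finally show ?thesis by (simp add: wt_def sum_distrib_left)
qed

lemma wt_le_1:
  assumes "uniform r V E" "subweight V w"
  shows "wt E w \<le> 1"
  using assms
proof (induction r arbitrary: E)
  case 0
  have "E \<subseteq> {{}}" using uniformD[OF 0(1)] by fastforce
  then have "E = {} \<or> E = {{}}" by auto
  then show ?case by (auto simp: wt_def)
next
  case (Suc r)
  have "real (Suc r) * wt E w = (\<Sum>v\<in>V. w v * wt (link v E) w)"
    by (rule sum_weight_link[OF Suc.prems(1), symmetric])
  also have "\<dots> \<le> (\<Sum>v\<in>V. w v * 1)"
    using Suc by (intro sum_mono mult_left_mono Suc.IH uniform_link) (auto dest: subweightD)
  also have "\<dots> \<le> 1" using Suc.prems by (simp add: subweight_def)
  finally have "real (Suc r) * wt E w \<le> 1" .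
  moreover have "wt E w \<le> real (Suc r) * wt E w"
    using mult_right_mono[of 1 "real (Suc r)" "wt E w"] wt_nonneg[OF Suc.prems] by simp
  ultimately show ?case by linarith
qed

text \<open>Discarding a set of vertices costs at most its weight, as every link has weight at most 1.\<close>

lemma wt_restrict:
  assumes "uniform (Suc r) V E" "subweight V w" "R \<subseteq> V"
  shows "wt E w \<le> wt {e \<in> E. e \<subseteq> R} w + sum w (V - R)"
proof -
  note fin = uniformD(1,2)[OF assms(1)]
  let ?p = "\<lambda>e. \<Prod>x\<in>e. w x"
  have pos: "0 \<le> ?p e" if "e \<in> E" for e
    using prod_nonneg_weight[OF assms(1,2) that order_refl] .
  have "wt E w = wt {e \<in> E. e \<subseteq> R} w + wt {e \<in> E. \<not> e \<subseteq> R} w"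
    unfolding wt_def using fin
    by (subst sum.union_disjoint[symmetric]) (auto intro!: sum.cong)
  also have "wt {e \<in> E. \<not> e \<subseteq> R} w \<le> (\<Sum>v\<in>V - R. \<Sum>e\<in>{e \<in> E. v \<in> e}. ?p e)"
    unfolding wt_def using fin uniformD(3)[OF assms(1)] pos by (intro sum_le_sum_cover) auto
  also have "\<dots> = (\<Sum>v\<in>V - R. w v * wt (link v E) w)"
    by (simp add: weight_times_link[OF assms(1)])
  also have "\<dots> \<le> (\<Sum>v\<in>V - R. w v * 1)"
    using assms(2) by (intro sum_mono mult_left_mono wt_le_1[OF uniform_link[OF assms(1)]]) (auto dest: subweightD)
  finally show ?thesis by simp
qed

lemma wt_split:
  assumes "uniform r V E"
  shows "wt E w = wt {e \<in> E. v \<notin> e} w + w v * wt (link v E) w"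
  unfolding weight_times_link[OF assms] unfolding wt_def
  by (subst sum.union_disjoint[symmetric]) (use uniformD(2)[OF assms] in \<open>auto intro!: sum.cong\<close>)

lemma wt_link_update: "wt (link v E) (w(v := t)) = wt (link v E) w"
  unfolding wt_link by (intro sum.cong prod.cong) auto

lemma wt_update:
  assumes "uniform r V E"
  shows "wt E (w(v := t)) = wt E w + (t - w v) * wt (link v E) w"
proof -
  have "wt {e \<in> E. v \<notin> e} (w(v := t)) = wt {e \<in> E. v \<notin> e} w"
    unfolding wt_def by (intro sum.cong prod.cong) auto
  then show ?thesis
    using wt_split[OF assms, of "w(v := t)" v] wt_split[OF assms, of w v]
    by (simp add: wt_link_update algebra_simps)
qed

lemma wt_scale:
  assumes "uniform r V E"
  shows "wt E (\<lambda>x. k * w x) = k ^ r * wt E w"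
  unfolding wt_def sum_distrib_left using uniformD(4)[OF assms]
  by (intro sum.cong) (auto simp: prod.distrib)

text \<open>Shifting a little mass \<^term>\<open>s\<close> towards a vertex \<^term>\<open>v\<close> must not push the weight beyond its
  maximum. Near the maximum this bounds the derivative at every vertex, whereas Euler's identity
  only bounds the average.\<close>

lemma link_upper_bound:
  assumes E: "uniform 3 V E" and w: "subweight V w" and v: "v \<in> V"
    and max: "\<And>w'. subweight V w' \<Longrightarrow> wt E w' \<le> lam" and lam: "0 \<le> lam" "lam \<le> 1/6"
    and s: "0 < s" "s \<le> 1/4" and near: "wt E w \<ge> lam - s\<^sup>2"
  shows "wt (link v E) w \<le> 3 * lam + 4 * s"
proof -
  define D where "D = wt (link v E) w"
  define w' where "w' = (\<lambda>x. (1 - s) * w x)"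
  have fV: "finite V" using E by (rule uniformD)
  have "sum (w'(v := w' v + s)) V = sum w' V + s"
    using fV v by (simp add: sum.remove[of V v] cong: if_cong)
  also have "\<dots> = (1 - s) * sum w V + s" by (simp add: w'_def sum_distrib_left)
  also have "\<dots> \<le> (1 - s) * 1 + s" using s w by (intro add_mono mult_left_mono) (auto simp: subweight_def)
  finally have "subweight V (w'(v := w' v + s))" using w s by (auto simp: subweight_def w'_def)
  then have "wt E (w'(v := w' v + s)) \<le> lam" by (rule max)
  moreover have "wt E (w'(v := w' v + s)) = wt E w' + s * wt (link v E) w'"
    using wt_update[OF E, of w' v "w' v + s"] by simp
  moreover have "wt E w' = (1 - s)^3 * wt E w" unfolding w'_def by (rule wt_scale[OF E])
  moreover have "uniform 2 V (link v E)" using uniform_link[of 2 V E v] E by (simp add: numeral_3_eq_3)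
  then have "wt (link v E) w' = (1 - s)^2 * D" unfolding w'_def D_def by (rule wt_scale)
  ultimately have "(1 - s)^3 * wt E w + s * ((1 - s)^2 * D) \<le> lam" by simp
  moreover have "(1 - s)^3 * (lam - s\<^sup>2) \<le> (1 - s)^3 * wt E w"
    using near s by (intro mult_left_mono) auto
  ultimately have "s * ((1 - s)^2 * D) \<le> lam - (1 - s)^3 * (lam - s\<^sup>2)" by linarith
  also have "\<dots> \<le> s * (3 * lam + s)"
  proof -
    have "(1 - s)^3 * s\<^sup>2 \<le> 1 * s\<^sup>2" using s by (intro mult_right_mono power_le_one) auto
    moreover have "lam * (1 - (1 - s)^3) \<le> lam * (3 * s)"
    proof (rule mult_left_mono)
      have "1 - (1 - s)^3 = 3 * s - s\<^sup>2 * (3 - s)" by (simp add: power2_eq_square power3_eq_cube algebra_simps)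
      moreover have "0 \<le> s\<^sup>2 * (3 - s)" using s by simp
      ultimately show "1 - (1 - s)^3 \<le> 3 * s" by linarith
    qed (use lam in simp)
    moreover have "s * (3 * lam + s) = lam * (3 * s) + s\<^sup>2" by (simp add: power2_eq_square algebra_simps)
    ultimately show ?thesis by (simp add: algebra_simps)
  qed
  finally have 1: "(1 - s)^2 * D \<le> 3 * lam + s" using s by (simp add: mult_le_cancel_left_pos)
  show ?thesis
  proof (rule ccontr)
    assume "\<not> ?thesis"
    then have "3 * lam + 4 * s < D" by (simp add: D_def)
    then have "(1 - s)^2 * (3 * lam + 4 * s) < (1 - s)^2 * D" using s by (intro mult_strict_left_mono) auto
    with 1 have "(1 - s)^2 * (3 * lam + 4 * s) < 3 * lam + s" by linarith
    moreover have "(1 - 2 * s) * (3 * lam + 4 * s) \<le> (1 - s)^2 * (3 * lam + 4 * s)"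
      using lam s by (intro mult_right_mono) (auto simp: power2_eq_square algebra_simps)
    ultimately have "4 * s < s + 6 * (lam * s) + 8 * s\<^sup>2" by (simp add: power2_eq_square algebra_simps)
    moreover have "lam * s \<le> 1/6 * s" using lam s by (intro mult_right_mono) auto
    moreover have "s\<^sup>2 \<le> 1/4 * s" using s by (simp add: power2_eq_square)
    ultimately show False using s by linarith
  qed
qed

text \<open>By Euler's identity the derivatives average to almost the upper bound just proved, so by Markov's
  inequality those that fall short of it by \<^term>\<open>\<theta>\<close> occur on little weight.\<close>

lemma small_link_weight:
  assumes E: "uniform 3 V E" and w: "subweight V w"
    and max: "\<And>w'. subweight V w' \<Longrightarrow> wt E w' \<le> lam" and lam: "0 \<le> lam" "lam \<le> 1/6"
    and s: "0 < s" "s \<le> 1/4" and near: "wt E w \<ge> lam - s\<^sup>2" and \<theta>: "0 < \<theta>"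
  shows "sum w (V - {v \<in> V. 0 < w v \<and> wt (link v E) w \<ge> 3 * lam - \<theta>}) \<le> 5 * s / \<theta>"
proof -
  let ?D = "\<lambda>v. wt (link v E) w"
  let ?B = "V - {v \<in> V. 0 < w v \<and> ?D v \<ge> 3 * lam - \<theta>}"
  have fV: "finite V" using E by (rule uniformD)
  have w0: "0 \<le> w v" if "v \<in> V" for v using w that by (rule subweightD)
  have up: "?D v \<le> 3 * lam + 4 * s" if "v \<in> V" for v
    by (rule link_upper_bound[OF E w that max lam s near])
  have "\<theta> * sum w ?B = (\<Sum>v\<in>?B. w v * \<theta>)" by (simp add: sum_distrib_left mult.commute)
  also have "\<dots> \<le> (\<Sum>v\<in>?B. w v * (3 * lam + 4 * s - ?D v))"
  proof (rule sum_mono)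
    fix v assume v: "v \<in> ?B"
    show "w v * \<theta> \<le> w v * (3 * lam + 4 * s - ?D v)"
    proof (cases "w v = 0")
      case False
      then have "?D v < 3 * lam - \<theta>" using v w0[of v] by auto
      then show ?thesis using w0[of v] v s by (intro mult_left_mono) auto
    qed simp
  qed
  also have "\<dots> \<le> (\<Sum>v\<in>V. w v * (3 * lam + 4 * s - ?D v))"
    using fV w0 up by (intro sum_mono2) auto
  also have "\<dots> = (\<Sum>v\<in>V. w v * (3 * lam + 4 * s)) - (\<Sum>v\<in>V. w v * ?D v)"
    by (simp only: right_diff_distrib sum_subtractf)
  also have "\<dots> = (3 * lam + 4 * s) * sum w V - 3 * wt E w"
    unfolding sum_weight_link[OF E] by (simp flip: sum_distrib_right)
  also have "\<dots> \<le> (3 * lam + 4 * s) * 1 - 3 * (lam - s\<^sup>2)"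
    using near lam s subweightD(2)[OF w] by (intro diff_mono mult_left_mono) auto
  also have "\<dots> \<le> 5 * s" using s by (simp add: power2_eq_square)
  finally show ?thesis using \<theta> by (simp add: pos_le_divide_eq mult.commute)
qed

section \<open>Blow-ups and transversals\<close>

definition fibre :: "('a \<Rightarrow> 'b) \<Rightarrow> 'a set \<Rightarrow> 'b \<Rightarrow> 'a set" where
  "fibre c R b = {y \<in> R. c y = b}"

text \<open>Injectivity of the colouring on an edge keeps edges with repeated colours out, whose image
  could be an edge only of a different uniformity.\<close>

definition blowup :: "('a \<Rightarrow> 'b) \<Rightarrow> 'a set \<Rightarrow> 'b set set \<Rightarrow> 'a set set" where
  "blowup c R E = {e. e \<subseteq> R \<and> inj_on c e \<and> c ` e \<in> E}"

lemma finite_fibre [simp]: "finite R \<Longrightarrow> finite (fibre c R b)"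
  by (simp add: fibre_def)

lemma uniform_blowup:
  assumes "uniform r C E" "finite R"
  shows "uniform r R (blowup c R E)"
  using assms unfolding uniform_def blowup_def by (auto simp: card_image[symmetric])

lemma sum_fibre:
  assumes "finite R" "finite C" "c ` R \<subseteq> C"
  shows "(\<Sum>b\<in>C. sum w (fibre c R b)) = sum w R"
  unfolding fibre_def using assms by (intro sum.group)

lemma subweight_fibre:
  assumes "subweight R w" "finite R" "finite C" "c ` R \<subseteq> C"
  shows "subweight C (\<lambda>b. sum w (fibre c R b))"
  using assms sum_fibre[OF assms(2-4), of w]
  by (auto simp: subweight_def fibre_def intro!: sum_nonneg)

text \<open>In the expansion of the product of class sums over an edge, each term selects one vertex from
  each class of this edge.\<close>

lemma wt_blowup:
  assumes E: "uniform r C E" and R: "finite R"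
  shows "wt (blowup c R E) w = wt E (\<lambda>b. sum w (fibre c R b))"
proof -
  note B = uniform_blowup[OF E R, of c]
  have "wt (blowup c R E) w = (\<Sum>f\<in>E. \<Sum>e\<in>{e \<in> blowup c R E. c ` e = f}. \<Prod>x\<in>e. w x)"
    unfolding wt_def using uniformD(2)[OF E] uniformD(2)[OF B]
    by (intro sum.group[symmetric]) (auto simp: blowup_def)
  also have "\<dots> = (\<Sum>f\<in>E. \<Sum>g\<in>PiE f (fibre c R). \<Prod>b\<in>f. w (g b))"
  proof (rule sum.cong)
    fix f assume f: "f \<in> E"
    have inj: "inj_on g f" if "g \<in> PiE f (fibre c R)" for g
      using that by (intro inj_on_inverseI[where g = c]) (auto simp: fibre_def PiE_iff)
    have img: "c ` g ` f = f" if "g \<in> PiE f (fibre c R)" for g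
      using that by (force simp: fibre_def PiE_iff image_iff)
    have "(\<Sum>g\<in>PiE f (fibre c R). \<Prod>b\<in>f. w (g b)) =
        (\<Sum>e\<in>{e \<in> blowup c R E. c ` e = f}. \<Prod>x\<in>e. w x)"
    proof (rule sum.reindex_bij_witness[where j = "\<lambda>g. g ` f"
          and i = "\<lambda>e. restrict (the_inv_into e c) f"])
      fix g assume g: "g \<in> PiE f (fibre c R)"
      have injc: "inj_on c (g ` f)"
        using g by (intro inj_on_inverseI[where g = g]) (auto simp: fibre_def PiE_iff)
      show "restrict (the_inv_into (g ` f) c) f = g"
      proof
        fix b
        show "restrict (the_inv_into (g ` f) c) f b = g b"
        proof (cases "b \<in> f")
          case True
          then have "c (g b) = b" using g by (auto simp: fibre_def PiE_iff)
          then show ?thesis using True the_inv_into_f_f[OF injc, of "g b"] by simp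
        qed (use g in \<open>auto simp: PiE_iff extensional_def\<close>)
      qed
      show "g ` f \<in> {e \<in> blowup c R E. c ` e = f}"
        using g f injc img[OF g] by (auto simp: blowup_def fibre_def PiE_iff)
      show "(\<Prod>x\<in>g ` f. w x) = (\<Prod>b\<in>f. w (g b))"
        using inj[OF g] by (simp add: prod.reindex)
    next
      fix e assume e: "e \<in> {e \<in> blowup c R E. c ` e = f}"
      then have injc: "inj_on c e" and ce: "c ` e = f" and eR: "e \<subseteq> R" by (auto simp: blowup_def)
      have "restrict (the_inv_into e c) f ` f = the_inv_into e c ` c ` e" using ce by (auto simp: image_iff)
      also have "\<dots> = e" using the_inv_into_onto[OF injc] by simp
      finally show "restrict (the_inv_into e c) f ` f = e" .
      show "restrict (the_inv_into e c) f \<in> PiE f (fibre c R)"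
        using ce eR injc by (auto simp: fibre_def f_the_inv_into_f the_inv_into_f_f)
    qed
    then show "(\<Sum>e\<in>{e \<in> blowup c R E. c ` e = f}. \<Prod>x\<in>e. w x) =
        (\<Sum>g\<in>PiE f (fibre c R). \<Prod>b\<in>f. w (g b))" by simp
  qed simp
  also have "\<dots> = wt E (\<lambda>b. sum w (fibre c R b))"
    unfolding wt_def
  proof (rule sum.cong)
    fix f assume "f \<in> E"
    then have "finite f" using uniformD(5)[OF E] by simp
    then show "(\<Sum>g\<in>PiE f (fibre c R). \<Prod>b\<in>f. w (g b)) = (\<Prod>b\<in>f. sum w (fibre c R b))"
      using R by (subst prod_sum_PiE) auto
  qed simp
  finally show ?thesis .
qed

text \<open>The weight of all transversals of the colour classes is the product of the class weights, and
  those passing through a given partial transversal \<^term>\<open>e\<close> weigh at most as much as \<^term>\<open>e\<close>. By the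
  union bound, some transversal avoids every member of a sufficiently light set \<^term>\<open>X\<close> of partial
  transversals.\<close>

lemma ex_transversal:
  assumes fin: "finite C" "finite R" "finite X"
    and c: "c ` R \<subseteq> C" and w: "subweight R w"
    and X: "\<And>e. e \<in> X \<Longrightarrow> e \<subseteq> R \<and> inj_on c e"
    and less: "wt X w < (\<Prod>b\<in>C. sum w (fibre c R b))"
  shows "\<exists>A \<in> PiE C (fibre c R). \<forall>e\<in>X. \<exists>x\<in>e. A (c x) \<noteq> x"
proof (rule ccontr)
  assume neg: "\<not> ?thesis"
  let ?T = "PiE C (fibre c R)" and ?p = "\<lambda>A. \<Prod>b\<in>C. w (A b)"
  define T where "T e = {A \<in> ?T. \<forall>x\<in>e. A (c x) = x}" for e
  have finT: "finite ?T" using fin by (intro finite_PiE) auto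
  have w0: "0 \<le> w x" if "x \<in> R" for x using w that by (rule subweightD)
  have fibR: "fibre c R b \<subseteq> R" for b by (auto simp: fibre_def)
  have p0: "0 \<le> ?p A" if "A \<in> ?T" for A
    using that fibR by (intro prod_nonneg w0) (auto simp: PiE_iff)
  have class1: "sum w (fibre c R b) \<le> 1" for b
    using subweightD(2)[OF subweight_subset[OF w fin(2) fibR]] .
  have class0: "0 \<le> sum w (fibre c R b)" for b
    using fibR[of b] w0 by (intro sum_nonneg) auto
  have through: "sum ?p (T e) \<le> (\<Prod>x\<in>e. w x)" if e: "e \<in> X" for e
  proof -
    have eR: "e \<subseteq> R" and inj: "inj_on c e" and fe: "finite e"
      using X[OF e] fin(2) by (auto intro: finite_subset)
    let ?B = "\<lambda>b. if b \<in> c ` e then e \<inter> fibre c R b else fibre c R b"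
    have B0: "0 \<le> sum w (?B b)" for b using fibR w0 by (intro sum_nonneg) (auto split: if_splits)
    have "sum ?p (T e) \<le> sum ?p (PiE C ?B)"
    proof (rule sum_mono2)
      show "finite (PiE C ?B)" using fin fe by (intro finite_PiE) auto
      show "T e \<subseteq> PiE C ?B"
      proof
        fix A assume "A \<in> T e"
        then have A: "A \<in> ?T" "\<And>x. x \<in> e \<Longrightarrow> A (c x) = x" by (auto simp: T_def)
        have "A b \<in> ?B b" if "b \<in> C" for b using A that by (auto simp: PiE_iff)
        then show "A \<in> PiE C ?B" using A(1) by (simp add: PiE_iff)
      qed
      show "0 \<le> ?p A" if "A \<in> PiE C ?B - T e" for A
        using that by (intro p0) (auto simp: PiE_iff split: if_splits)
    qed
    also have "\<dots> = (\<Prod>b\<in>C. sum w (?B b))" using fin fe by (subst prod_sum_PiE) auto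
    also have "\<dots> = (\<Prod>b\<in>c ` e. sum w (?B b)) * (\<Prod>b\<in>C - c ` e. sum w (?B b))"
      by (subst prod.subset_diff[of "c ` e" C]) (use fin(1) c eR in \<open>auto simp: mult.commute\<close>)
    also have "\<dots> \<le> (\<Prod>b\<in>c ` e. sum w (?B b)) * 1"
    proof (rule mult_left_mono)
      show "(\<Prod>b\<in>C - c ` e. sum w (?B b)) \<le> 1" using class0 class1 by (intro prod_le_1) auto
      show "0 \<le> (\<Prod>b\<in>c ` e. sum w (?B b))" by (intro prod_nonneg B0)
    qed
    also have "\<dots> = (\<Prod>x\<in>e. sum w (?B (c x)))" using inj by (simp add: prod.reindex)
    also have "\<dots> = (\<Prod>x\<in>e. w x)"
    proof (rule prod.cong)
      fix x assume x: "x \<in> e"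
      then have "?B (c x) = {x}" using eR inj by (auto simp: fibre_def dest: inj_onD)
      then show "sum w (?B (c x)) = w x" by simp
    qed simp
    finally show ?thesis .
  qed
  have "(\<Prod>b\<in>C. sum w (fibre c R b)) = sum ?p ?T" using fin by (subst prod_sum_PiE) auto
  also have "\<dots> \<le> (\<Sum>e\<in>X. sum ?p (T e))"
    using fin finT neg p0 by (intro sum_le_sum_cover) (auto simp: T_def)
  also have "\<dots> \<le> wt X w" unfolding wt_def by (intro sum_mono through)
  finally show False using less by simp
qed

section \<open>Rigid patterns\<close>

text \<open>The last clause says that the uniform distribution is the unique
  maximiser of the weight, quantitatively; by the clause on the number of edges, the maximum
  \<^term>\<open>lam\<close> is attained there.\<close>

definition pattern :: "real \<Rightarrow> nat \<Rightarrow> nat set set \<Rightarrow> bool" where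
  "pattern lam n E \<longleftrightarrow> uniform 3 {..<n} E \<and> 3 \<le> n \<and>
     (\<forall>u<n. \<forall>v<n. u \<noteq> v \<longrightarrow> (\<exists>e\<in>E. u \<in> e \<and> v \<in> e)) \<and>
     real (card E) = lam * real n ^ 3 \<and>
     (\<forall>\<alpha>. (\<forall>b<n. 0 \<le> \<alpha> b) \<and> sum \<alpha> {..<n} = 1 \<longrightarrow>
        wt E \<alpha> \<le> lam - 1/18 * (\<Sum>b<n. (\<alpha> b - 1 / real n)\<^sup>2))"

lemma patternD:
  assumes "pattern lam n E"
  shows "uniform 3 {..<n} E" "3 \<le> n" "real (card E) = lam * real n ^ 3"
    and "u < n \<Longrightarrow> v < n \<Longrightarrow> u \<noteq> v \<Longrightarrow> \<exists>e\<in>E. u \<in> e \<and> v \<in> e"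
    and "(\<And>b. b < n \<Longrightarrow> 0 \<le> \<alpha> b) \<Longrightarrow> sum \<alpha> {..<n} = 1 \<Longrightarrow>
        wt E \<alpha> \<le> lam - 1/18 * (\<Sum>b<n. (\<alpha> b - 1 / real n)\<^sup>2)"
  using assms unfolding pattern_def by auto

lemma wt_const: "uniform r V E \<Longrightarrow> wt E (\<lambda>_. k) = real (card E) * k ^ r"
  by (simp add: wt_def uniformD(4))

text \<open>Missing mass may be put on any vertex: this completes a vector of total mass at most 1
  without changing another chosen coordinate.\<close>

lemma complete_mass:
  assumes E: "uniform r V E" and w: "subweight V w" and v: "v \<in> V"
  defines "w' \<equiv> w(v := w v + (1 - sum w V))"
  shows "\<forall>x\<in>V. 0 \<le> w' x" "sum w' V = 1" "wt E w \<le> wt E w'"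
proof -
  have fV: "finite V" using E by (rule uniformD)
  show "\<forall>x\<in>V. 0 \<le> w' x" using w by (auto simp: w'_def subweight_def)
  show "sum w' V = 1" using fV v by (simp add: w'_def sum.remove[of V v] cong: if_cong)
  show "wt E w \<le> wt E w'"
  proof (cases r)
    case 0
    then have "\<forall>e\<in>E. e = {}" using uniformD(4,5)[OF E] by auto
    then have "wt E w = wt E w'" unfolding wt_def by (intro sum.cong prod.cong) auto
    then show ?thesis by simp
  next
    case (Suc k)
    then have "0 \<le> wt (link v E) w"
      using E w by (intro wt_nonneg[OF uniform_link]) auto
    moreover have "0 \<le> 1 - sum w V" using subweightD(2)[OF w] by simp
    ultimately have "0 \<le> (1 - sum w V) * wt (link v E) w" by simp
    then show ?thesis unfolding w'_def by (simp add: wt_update[OF E])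
  qed
qed

lemma pattern_le:
  assumes "pattern lam n E" "subweight {..<n} \<alpha>"
  shows "wt E \<alpha> \<le> lam"
proof -
  have "0 \<in> {..<n}" using patternD(2)[OF assms(1)] by simp
  note 1 = complete_mass[OF patternD(1)[OF assms(1)] assms(2) this]
  then have "wt E (\<alpha>(0 := \<alpha> 0 + (1 - sum \<alpha> {..<n}))) \<le> lam - 1/18 * (\<Sum>b<n. ((\<alpha>(0 := \<alpha> 0 + (1 - sum \<alpha> {..<n}))) b - 1 / real n)\<^sup>2)"
    using patternD(5)[OF assms(1)] by blast
  moreover have "0 \<le> (\<Sum>b<n. ((\<alpha>(0 := \<alpha> 0 + (1 - sum \<alpha> {..<n}))) b - 1 / real n)\<^sup>2)"
    by (intro sum_nonneg) auto
  ultimately show ?thesis using 1(3) by linarith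
qed

lemma pattern_near:
  assumes P: "pattern lam n E" and \<alpha>: "subweight {..<n} \<alpha>" and near: "wt E \<alpha> \<ge> lam - \<tau>\<^sup>2"
    and \<tau>: "0 \<le> \<tau>" and b: "b < n"
  shows "\<bar>\<alpha> b - 1 / real n\<bar> \<le> 5 * \<tau>"
proof -
  define b' :: nat where "b' = (if b = 0 then 1 else 0)"
  have b': "b' \<in> {..<n}" "b' \<noteq> b" using patternD(2)[OF P] by (auto simp: b'_def)
  define \<alpha>' where "\<alpha>' = \<alpha>(b' := \<alpha> b' + (1 - sum \<alpha> {..<n}))"
  note 1 = complete_mass[OF patternD(1)[OF P] \<alpha> b'(1), folded \<alpha>'_def]
  have "(\<alpha>' b - 1 / real n)\<^sup>2 \<le> (\<Sum>b<n. (\<alpha>' b - 1 / real n)\<^sup>2)"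
    using b by (intro member_le_sum) auto
  moreover have "wt E \<alpha>' \<le> lam - 1/18 * (\<Sum>b<n. (\<alpha>' b - 1 / real n)\<^sup>2)"
    using 1 patternD(5)[OF P] by auto
  ultimately have "(\<alpha>' b - 1 / real n)\<^sup>2 \<le> 18 * \<tau>\<^sup>2" using near 1(3) by linarith
  moreover have "18 * \<tau>\<^sup>2 \<le> (5 * \<tau>)\<^sup>2" by (simp add: power_mult_distrib)
  moreover have "\<alpha>' b = \<alpha> b" using b' by (simp add: \<alpha>'_def)
  ultimately have "(\<alpha> b - 1 / real n)\<^sup>2 \<le> (5 * \<tau>)\<^sup>2" by (metis order_trans)
  then show ?thesis using \<tau> abs_le_square_iff[of "\<alpha> b - 1 / real n" "5 * \<tau>"] by simp
qed

text \<open>A homomorphism between two patterns with the same \<^term>\<open>lam\<close> is injective since every pair of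
  vertices lies in an edge. It then carries the uniform distribution to a maximiser of the target,
  which has only one, namely its own uniform distribution.\<close>

lemma pattern_hom:
  assumes P: "pattern lam n E" and Q: "pattern lam m F"
    and \<psi>: "\<psi> ` {..<n} \<subseteq> {..<m}" "\<And>f. f \<in> E \<Longrightarrow> \<psi> ` f \<in> F"
  shows "inj_on \<psi> {..<n}" "n = m"
proof -
  note uE = patternD(1)[OF P] and uF = patternD(1)[OF Q]
  have inj_e: "inj_on \<psi> e" if "e \<in> E" for e
    using uniformD(4,5)[OF uE that] uniformD(4)[OF uF \<psi>(2)[OF that]] by (intro eq_card_imp_inj_on) auto
  show inj: "inj_on \<psi> {..<n}"
  proof (rule inj_onI, rule ccontr)
    fix u v assume "u \<in> {..<n}" "v \<in> {..<n}" "\<psi> u = \<psi> v" "u \<noteq> v"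
    moreover from this obtain e where "e \<in> E" "u \<in> e" "v \<in> e" using patternD(4)[OF P] by fastforce
    ultimately show False using inj_e by (auto dest: inj_onD)
  qed
  have n0: "0 < n" "0 < m" using patternD(2)[OF P] patternD(2)[OF Q] by auto
  let ?u = "\<lambda>_::nat. 1 / real n"
  define \<alpha> where "\<alpha> b = sum ?u (fibre \<psi> {..<n} b)" for b
  have u: "subweight {..<n} ?u" using n0 by (simp add: subweight_def)
  have \<alpha>: "subweight {..<m} \<alpha>" unfolding \<alpha>_def using u \<psi>(1) by (intro subweight_fibre) auto
  have "lam = wt E ?u" using wt_const[OF uE] patternD(3)[OF P] n0 by (simp add: power_divide)
  also have "\<dots> \<le> wt (blowup \<psi> {..<n} F) ?u"
    using uniformD(3)[OF uE] inj_e \<psi>(2) u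
    by (intro wt_mono[OF uniform_blowup[OF uF]]) (auto simp: blowup_def)
  also have "\<dots> = wt F \<alpha>" unfolding \<alpha>_def by (rule wt_blowup[OF uF]) simp
  finally have "lam - 0\<^sup>2 \<le> wt F \<alpha>" by simp
  moreover have "\<psi> 0 < m" using n0 \<psi>(1) by auto
  ultimately have "\<bar>\<alpha> (\<psi> 0) - 1 / real m\<bar> \<le> 5 * 0" by (intro pattern_near[OF Q \<alpha>]) auto
  moreover have "fibre \<psi> {..<n} (\<psi> 0) = {0}" using inj n0 by (auto simp: fibre_def dest: inj_onD)
  ultimately have "1 / real n = 1 / real m" by (simp add: \<alpha>_def)
  then show "n = m" using n0 by simp
qed

section \<open>Local colourability implies global colourability\<close>

text \<open>The parameter \<^term>\<open>\<theta>\<close> is the tolerance up to which near-extremal weightings are still rigid.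
  In a near-extremal weighting every colour class has weight at least \<^term>\<open>1 / (2 * l) :: real\<close>, so
  the last assumption makes the transversals of the classes outweigh all defects together: at most
  \<^term>\<open>\<theta>\<^sup>2\<close> for the missing edges and \<^term>\<open>6 * \<theta>\<close> for the missing link edges at each of
  \<^term>\<open>2 * l\<close> vertices.\<close>

locale pattern_family =
  fixes I :: "nat set" and n :: "nat \<Rightarrow> nat" and E :: "nat \<Rightarrow> nat set set"
    and lam :: real and l :: nat and \<theta> :: real
  assumes pat: "i \<in> I \<Longrightarrow> pattern lam (n i) (E i)"
    and inj_n: "inj_on n I"
    and n_le: "i \<in> I \<Longrightarrow> n i \<le> l"
    and lam: "0 \<le> lam" "lam \<le> 1/6"
    and \<theta>: "0 < \<theta>" "\<theta> \<le> 1/4" "10 * real l * \<theta> \<le> 1" "\<theta>\<^sup>2 + 12 * real l * \<theta> < (1 / (2 * real l)) ^ l"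
begin

definition colouring :: "nat \<Rightarrow> 'a set set \<Rightarrow> 'a set \<Rightarrow> ('a \<Rightarrow> nat) \<Rightarrow> bool" where
  "colouring i H R c \<longleftrightarrow> c ` R \<subseteq> {..<n i} \<and> (\<forall>e\<in>H. e \<subseteq> R \<longrightarrow> c ` e \<in> E i)"

text \<open>The bound leaves room for \<^term>\<open>l + 1\<close> vertices together with an edge, of three vertices, for
  each ordered pair of them. It also exceeds the number \<^term>\<open>3 * l + 1\<close> of vertices inspected when a
  colouring is extended.\<close>

definition locally_colourable :: "'a set \<Rightarrow> 'a set set \<Rightarrow> bool" where
  "locally_colourable V H \<longleftrightarrow> uniform 3 V H \<and>
     (\<forall>X\<subseteq>V. card X \<le> 3 * (l + 1)\<^sup>2 \<longrightarrow> (\<exists>i\<in>I. \<exists>c. colouring i H X c))"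

lemma locally_colourableD:
  assumes "locally_colourable V H"
  shows "uniform 3 V H" "X \<subseteq> V \<Longrightarrow> card X \<le> 3 * (l + 1)\<^sup>2 \<Longrightarrow> \<exists>i\<in>I. \<exists>c. colouring i H X c"
  using assms unfolding locally_colourable_def by auto

lemma colouring_subset: "colouring i H R c \<Longrightarrow> R' \<subseteq> R \<Longrightarrow> colouring i H R' c"
  unfolding colouring_def by blast

lemma edges_in_blowup:
  assumes "uniform 3 V H" "i \<in> I" "colouring i H R c"
  shows "{e \<in> H. e \<subseteq> R} \<subseteq> blowup c R (E i)"
proof
  fix e assume e: "e \<in> {e \<in> H. e \<subseteq> R}"
  then have ce: "c ` e \<in> E i" using assms(3) by (auto simp: colouring_def)
  then have "card (c ` e) = card e"
    using e uniformD(4)[OF assms(1)] uniformD(4)[OF patternD(1)[OF pat[OF assms(2)]]] by auto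
  then have "inj_on c e" using e uniformD(5)[OF assms(1)] by (auto intro: eq_card_imp_inj_on)
  then show "e \<in> blowup c R (E i)" using e ce by (auto simp: blowup_def)
qed

text \<open>By \<open>pattern_hom\<close> only the pattern itself colours a copy of it, and injectively. An injective map
  of the finite edge set into itself is onto, so non-edges go to non-edges.\<close>

lemma colouring_of_copy:
  assumes i: "i \<in> I" and j: "j \<in> I" and \<psi>: "colouring j H X \<psi>"
    and A: "A ` {..<n i} \<subseteq> X" "\<And>f. f \<in> E i \<Longrightarrow> A ` f \<in> H"
  shows "j = i" "bij_betw (\<psi> \<circ> A) {..<n i} {..<n i}"
    and "f \<subseteq> {..<n i} \<Longrightarrow> (\<psi> \<circ> A) ` f \<in> E i \<Longrightarrow> f \<in> E i"
proof -
  let ?\<sigma> = "\<psi> \<circ> A"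
  note uE = patternD(1)[OF pat[OF i]]
  have img: "?\<sigma> ` {..<n i} \<subseteq> {..<n j}" 
    using \<psi> image_mono[OF A(1), of \<psi>] unfolding colouring_def image_comp by (blast intro: order_trans)
  have edge: "?\<sigma> ` f \<in> E j" if f: "f \<in> E i" for f
  proof -
    have "A ` f \<subseteq> X" using A(1) uniformD(3)[OF uE f] by auto
    then have "\<psi> ` A ` f \<in> E j" using \<psi> A(2)[OF f] unfolding colouring_def by blast
    then show ?thesis by (simp add: image_comp)
  qed
  note hom = pattern_hom[OF pat[OF i] pat[OF j] img edge]
  show ji: "j = i" using hom(2) inj_n i j by (auto dest: inj_onD)
  have "?\<sigma> ` {..<n i} = {..<n i}" using hom(1) img ji by (intro endo_inj_surj) auto
  then show bij: "bij_betw ?\<sigma> {..<n i} {..<n i}" using hom(1) by (simp add: bij_betw_def)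
  have "inj_on (image ?\<sigma>) (E i)"
    using uniformD(3)[OF uE] by (intro inj_on_subset[OF inj_on_image_Pow[OF bij_betw_imp_inj_on[OF bij]]]) auto
  then have surj: "image ?\<sigma> ` E i = E i"
    using edge ji uniformD(2)[OF uE] by (intro endo_inj_surj) auto
  show "f \<in> E i" if f: "f \<subseteq> {..<n i}" "?\<sigma> ` f \<in> E i"
  proof -
    obtain g where g: "g \<in> E i" "?\<sigma> ` f = ?\<sigma> ` g" using f(2) surj by (metis imageE)
    then have "f = g"
      using inj_on_image_eq_iff[OF bij_betw_imp_inj_on[OF bij] f(1) uniformD(3)[OF uE g(1)]] by blast
    then show ?thesis using g by simp
  qed
qed

text \<open>A vertex \<^term>\<open>y\<close> joined to a copy \<^term>\<open>A\<close> as vertex \<^term>\<open>b\<close> of the copy is must receive the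
  colour of that vertex: any other colour is used by some \<^term>\<open>A b'\<close>, and \<^term>\<open>b\<close>, \<^term>\<open>b'\<close> lie in a
  common edge.\<close>

lemma colour_of_attached:
  assumes H: "uniform 3 V H" and i: "i \<in> I" and \<psi>: "colouring i H X \<psi>"
    and A: "A ` {..<n i} \<subseteq> X" "bij_betw (\<psi> \<circ> A) {..<n i} {..<n i}"
    and y: "y \<in> X" "b < n i" "\<And>b'. b' < n i \<Longrightarrow> b' \<noteq> b \<Longrightarrow> A b' \<noteq> y"
    and att: "\<And>f. f \<in> E i \<Longrightarrow> b \<in> f \<Longrightarrow> insert y (A ` (f - {b})) \<in> H"
  shows "\<psi> y = \<psi> (A b)"
proof (rule ccontr)
  assume ne: "\<psi> y \<noteq> \<psi> (A b)"
  note uE = patternD(1)[OF pat[OF i]]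
  have "\<psi> y \<in> (\<psi> \<circ> A) ` {..<n i}" using \<psi> y(1) A(2) by (auto simp: colouring_def bij_betw_def)
  then obtain b' where b': "b' < n i" "\<psi> y = \<psi> (A b')" by auto
  then have "b' \<noteq> b" using ne by auto
  then obtain f where f: "f \<in> E i" "b \<in> f" "b' \<in> f" using patternD(4)[OF pat[OF i]] b' y(2) by metis
  let ?e = "insert y (A ` (f - {b}))"
  have e: "?e \<in> H" using att f by auto
  have "?e \<subseteq> X" using y(1) A(1) uniformD(3)[OF uE f(1)] by auto
  then have "\<psi> ` ?e \<in> E i" using e \<psi> unfolding colouring_def by blast
  then have "card (\<psi> ` ?e) = card ?e" using uniformD(4)[OF uE] uniformD(4)[OF H e] by simp
  then have "inj_on \<psi> ?e" using uniformD(5)[OF H e] by (rule eq_card_imp_inj_on[rotated])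
  then have "y = A b'" using b' f \<open>b' \<noteq> b\<close> by (auto dest: inj_onD)
  then show False using y(3) b' \<open>b' \<noteq> b\<close> by blast
qed


text \<open>The coloured part \<^term>\<open>R\<close> carries almost the maximal weight. The blow-up of the pattern along
  the colouring contains it and weighs at most \<^term>\<open>lam\<close>, so little is missing, and by rigidity the class weights are almost
  equal.\<close>

lemma near_extremal_colouring:
  assumes H: "uniform 3 V H" and i: "i \<in> I" and w: "subweight V w" and R: "R \<subseteq> V"
    and near: "wt H w \<ge> lam - s\<^sup>2" and rest: "sum w (V - R) \<le> \<rho>" and small: "s\<^sup>2 + \<rho> \<le> \<tau>\<^sup>2" "0 \<le> \<tau>"
    and c: "colouring i H R c"
  shows "wt (blowup c R (E i) - H) w \<le> \<tau>\<^sup>2"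
    and "wt (blowup c R (E i)) w \<ge> lam - \<tau>\<^sup>2"
    and "b < n i \<Longrightarrow> \<bar>sum w (fibre c R b) - 1 / real (n i)\<bar> \<le> 5 * \<tau>"
proof -
  let ?B = "blowup c R (E i)" and ?HR = "{e \<in> H. e \<subseteq> R}"
  note uE = patternD(1)[OF pat[OF i]]
  have fR: "finite R" using R uniformD(1)[OF H] by (rule finite_subset)
  note uB = uniform_blowup[OF uE fR, of c]
  have wR: "subweight R w" using subweight_subset[OF w uniformD(1)[OF H] R] .
  have \<alpha>: "subweight {..<n i} (\<lambda>b. sum w (fibre c R b))"
    using subweight_fibre[OF wR fR, of "{..<n i}" c] c by (auto simp: colouring_def)
  have HRB: "?HR \<subseteq> ?B" by (rule edges_in_blowup[OF H i c])
  have "wt ?HR w \<ge> wt H w - sum w (V - R)"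
    using wt_restrict[of 2 V H w R] H w R by (simp add: numeral_3_eq_3)
  then have HR: "wt ?HR w \<ge> lam - \<tau>\<^sup>2" using near rest small by linarith
  also have "wt ?HR w \<le> wt ?B w" by (rule wt_mono[OF uB wR HRB])
  finally show B: "wt ?B w \<ge> lam - \<tau>\<^sup>2" .
  have "wt ?B w \<le> lam"
    unfolding wt_blowup[OF uE fR] by (rule pattern_le[OF pat[OF i] \<alpha>])
  moreover have "?B - H = ?B - ?HR" by (auto simp: blowup_def)
  ultimately show "wt (?B - H) w \<le> \<tau>\<^sup>2" using HR HRB uniformD(2)[OF uB] by (simp add: wt_diff)
  show "\<bar>sum w (fibre c R b) - 1 / real (n i)\<bar> \<le> 5 * \<tau>" if "b < n i"
    using B unfolding wt_blowup[OF uE fR]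
    by (rule pattern_near[OF pat[OF i] \<alpha> _ small(2) that])
qed

lemma l_pos: "i \<in> I \<Longrightarrow> 3 \<le> l"
  using patternD(2)[OF pat] n_le by (meson order_trans)

text \<open>Suppose every colour \<^term>\<open>a\<close> were excluded for \<^term>\<open>z\<close> by an edge through \<^term>\<open>z\<close>. The
  at most \<^term>\<open>2 * l\<close> further vertices of these edges have almost full links, so some copy
  \<^term>\<open>A\<close> of the pattern has all of them attached. In a colouring of these boundedly many vertices
  the copy determines, up to an automorphism, the colours of all vertices but \<^term>\<open>z\<close>, so that
  whichever colour \<^term>\<open>z\<close> receives is refuted.\<close>

lemma extend_colouring:
  assumes lc: "locally_colourable V H" and w: "subweight V w" and R: "R \<subseteq> V"
    and near: "wt H w \<ge> lam - s\<^sup>2" and rest: "sum w (V - R) \<le> \<rho>"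
    and small: "s\<^sup>2 + \<rho> \<le> \<theta>\<^sup>2" "\<rho> \<le> \<theta>"
    and big: "\<And>y. y \<in> R \<Longrightarrow> wt (link y H) w \<ge> 3 * lam - \<theta>"
    and i: "i \<in> I" and c: "colouring i H R c" and z: "z \<in> V"
  obtains a where "a < n i" "\<And>e. e \<in> H \<Longrightarrow> z \<in> e \<Longrightarrow> e - {z} \<subseteq> R \<Longrightarrow> insert a (c ` (e - {z})) \<in> E i"
proof (rule ccontr)
  assume neg: "\<not> thesis"
  note H = locally_colourableD(1)[OF lc]
  note uE = patternD(1)[OF pat[OF i]]
  define C where "C = {..<n i}"
  have "\<forall>a<n i. \<exists>e. e \<in> H \<and> z \<in> e \<and> e - {z} \<subseteq> R \<and> insert a (c ` (e - {z})) \<notin> E i"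
    using neg that by blast
  then obtain g where g: "\<And>a. a < n i \<Longrightarrow> g a \<in> H \<and> z \<in> g a \<and> g a - {z} \<subseteq> R \<and> insert a (c ` (g a - {z})) \<notin> E i"
    by metis
  define Q where "Q = (\<Union>a\<in>C. g a - {z})"
  have QR: "Q \<subseteq> R" using g by (auto simp: Q_def C_def)
  have cardQ: "card Q \<le> 2 * l"
  proof -
    have "card Q \<le> (\<Sum>a\<in>C. card (g a - {z}))" unfolding Q_def by (rule card_UN_le) (simp add: C_def)
    also have "\<dots> = (\<Sum>a\<in>C. 2)"
      using g uniformD(4)[OF H] by (intro sum.cong) (auto simp: C_def card_Diff_singleton)
    also have "\<dots> \<le> 2 * l" using n_le[OF i] by (simp add: C_def)
    finally show ?thesis .
  qed
  have fV: "finite V" using H by (rule uniformD)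
  have fR: "finite R" using R fV by (rule finite_subset)
  have fQ: "finite Q" using QR fR by (rule finite_subset)
  have wR: "subweight R w" using subweight_subset[OF w fV R] .
  have cR: "c ` R \<subseteq> C" using c by (simp add: colouring_def C_def)
  define B where "B = blowup c R (E i)"
  note ne = near_extremal_colouring[OF H i w R near rest small(1) less_imp_le[OF \<theta>(1)] c, folded B_def]
  have uB: "uniform 3 R B" unfolding B_def by (rule uniform_blowup[OF uE fR])
  have uB2: "uniform 2 R (link y B)" for y using uniform_link[of 2 R B y] uB by (simp add: numeral_3_eq_3)
  have uH2: "uniform 2 V (link y H)" for y using uniform_link[of 2 V H y] H by (simp add: numeral_3_eq_3)
  have maxB: "wt B w' \<le> lam" if "subweight R w'" for w'
    unfolding B_def wt_blowup[OF uE fR]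
    using that fR cR by (intro pattern_le[OF pat[OF i]] subweight_fibre) (auto simp: C_def)
  \<comment> \<open>The derivative of the blow-up exceeds \<^term>\<open>3 * lam\<close> by at most \<^term>\<open>4 * \<theta>\<close>; that of \<^term>\<open>H\<close> falls
    short of it by at most \<^term>\<open>\<theta>\<close>, and loses at most \<^term>\<open>\<rho>\<close> more when restricted to \<^term>\<open>R\<close>.\<close>
  have missing: "wt (link y (B - H)) w \<le> 6 * \<theta>" if y: "y \<in> Q" for y
  proof -
    have yR: "y \<in> R" using y QR by blast
    have "wt (link y B) w \<le> 3 * lam + 4 * \<theta>"
      by (rule link_upper_bound[OF uB wR yR maxB lam \<theta>(1,2) ne(2)])
    moreover have "wt (link y H) w \<le> wt {f \<in> link y H. f \<subseteq> R} w + sum w (V - R)"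
      using wt_restrict[of 1 V "link y H" w R] uH2[of y] w R by (simp add: numeral_2_eq_2)
    moreover have "{f \<in> link y H. f \<subseteq> R} = link y {e \<in> H. e \<subseteq> R}"
      using yR unfolding link_def by blast
    moreover have "B - H = B - {e \<in> H. e \<subseteq> R}" using uniformD(3)[OF uB] by blast
    then have "link y (B - H) = link y B - link y {e \<in> H. e \<subseteq> R}" by (simp add: link_Diff)
    moreover have "link y {e \<in> H. e \<subseteq> R} \<subseteq> link y B"
      unfolding B_def by (intro link_mono edges_in_blowup[OF H i c])
    ultimately show ?thesis
      using big[OF yR] rest small(2) wt_diff[OF uniformD(2)[OF uB2[of y]], of "link y {e \<in> H. e \<subseteq> R}" w] by simp
  qed
  \<comment> \<open>A transversal avoiding \<^term>\<open>X\<close> is a copy of the pattern to which every vertex of \<^term>\<open>Q\<close> is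
    joined like the vertex of its colour.\<close>
  define X where "X = (B - H) \<union> (\<Union>y\<in>Q. link y (B - H))"
  have X: "e \<subseteq> R \<and> inj_on c e" if "e \<in> X" for e
    using that unfolding X_def B_def blowup_def link_def by (auto intro: inj_on_subset)
  have fX: "finite X" using X fR by (auto intro: finite_subset[of X "Pow R"])
  have l3: "3 \<le> l" by (rule l_pos[OF i])
  have "wt X w < (\<Prod>b\<in>C. sum w (fibre c R b))"
  proof -
    have p0: "0 \<le> (\<Prod>x\<in>e. w x)" if "e \<in> X" for e
      using X[OF that] by (intro prod_nonneg subweightD(1)[OF wR]) auto
    have "wt X w \<le> wt (B - H) w + wt (\<Union>y\<in>Q. link y (B - H)) w"
    proof -
      have "wt X w + wt ((B - H) \<inter> (\<Union>y\<in>Q. link y (B - H))) w = wt (B - H) w + wt (\<Union>y\<in>Q. link y (B - H)) w"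
        using fX unfolding X_def wt_def by (intro sum.union_inter) auto
      moreover have "0 \<le> wt ((B - H) \<inter> (\<Union>y\<in>Q. link y (B - H))) w"
        unfolding wt_def by (rule sum_nonneg) (auto simp: X_def intro!: p0)
      ultimately show ?thesis by linarith
    qed
    also have "wt (\<Union>y\<in>Q. link y (B - H)) w \<le> (\<Sum>y\<in>Q. wt (link y (B - H)) w)"
      unfolding wt_def using fQ fX by (intro sum_le_sum_cover p0) (auto simp: X_def)
    also have "\<dots> \<le> (\<Sum>y\<in>Q. 6 * \<theta>)" by (intro sum_mono missing)
    also have "\<dots> \<le> 2 * real l * (6 * \<theta>)"
      using cardQ \<theta>(1) by simp
    finally have "wt X w \<le> \<theta>\<^sup>2 + 12 * real l * \<theta>" using ne(1) by simp
    also have "\<dots> < (1 / (2 * real l)) ^ l" by (rule \<theta>)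
    also have "\<dots> \<le> (1 / (2 * real l)) ^ n i" using n_le[OF i] l3 by (intro power_decreasing) auto
    also have "\<dots> = (\<Prod>b\<in>C. 1 / (2 * real l))" by (simp add: C_def)
    also have "\<dots> \<le> (\<Prod>b\<in>C. sum w (fibre c R b))"
    proof (rule prod_mono)
      fix b assume "b \<in> C"
      then have "\<bar>sum w (fibre c R b) - 1 / real (n i)\<bar> \<le> 5 * \<theta>" using ne(3) by (auto simp: C_def)
      moreover have "1 / real l \<le> 1 / real (n i)"
        using n_le[OF i] patternD(2)[OF pat[OF i]] by (intro divide_left_mono) auto
      moreover have "5 * \<theta> \<le> 1 / (2 * real l)" using \<theta>(3) l3 by (simp add: field_simps)
      moreover have "1 / real l = 2 * (1 / (2 * real l))" by simp
      ultimately have "1 / (2 * real l) \<le> sum w (fibre c R b)" by linarith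
      then show "0 \<le> 1 / (2 * real l) \<and> 1 / (2 * real l) \<le> sum w (fibre c R b)" by simp
    qed
    finally show ?thesis .
  qed
  then obtain A where A: "A \<in> PiE C (fibre c R)" "\<And>e. e \<in> X \<Longrightarrow> \<exists>x\<in>e. A (c x) \<noteq> x"
    using ex_transversal[OF _ fR fX cR wR X] by (auto simp: C_def)
  have AR: "A b \<in> R" and cA: "c (A b) = b" if "b \<in> C" for b
    using A(1) that by (auto simp: PiE_iff fibre_def)
  have cAim: "c ` A ` f = f" if "f \<subseteq> C" for f using that cA by (force simp: image_iff)
  have injcA: "inj_on c (A ` f)" if "f \<subseteq> C" for f
    using that cA by (intro inj_on_inverseI[where g = A]) auto
  have copy: "A ` f \<in> H" if f: "f \<in> E i" for f
  proof (rule ccontr)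
    assume "A ` f \<notin> H"
    moreover have fC: "f \<subseteq> C" using uniformD(3)[OF uE f] by (simp add: C_def)
    then have "A ` f \<in> B" using f cAim[OF fC] injcA[OF fC] AR by (auto simp: B_def blowup_def)
    ultimately have "A ` f \<in> X" by (simp add: X_def)
    then show False using A(2)[of "A ` f"] cA fC by (auto simp: subset_iff)
  qed
  have attached: "insert y (A ` (f - {c y})) \<in> H" if y: "y \<in> Q" and f: "f \<in> E i" "c y \<in> f" for y f
  proof (rule ccontr)
    let ?e = "A ` (f - {c y})"
    assume "insert y ?e \<notin> H"
    have fC: "f \<subseteq> C" using uniformD(3)[OF uE f(1)] by (simp add: C_def)
    then have f'C: "f - {c y} \<subseteq> C" by blast
    have ce: "c ` ?e = f - {c y}" by (rule cAim[OF f'C])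
    then have "y \<notin> ?e" by blast
    moreover have "insert y ?e \<in> B"
      using f(1) QR y AR f'C fC ce insert_absorb[OF f(2)] injcA[OF f'C] unfolding B_def blowup_def
      by auto
    ultimately have "?e \<in> link y (B - H)"
      using \<open>insert y ?e \<notin> H\<close> unfolding link_def by (intro image_eqI[of _ _ "insert y ?e"]) auto
    then have "?e \<in> X" using y by (auto simp: X_def)
    then show False using A(2)[of ?e] cA f'C by (auto simp: subset_iff)
  qed
  define Y where "Y = insert z (A ` C \<union> Q)"
  have YV: "Y \<subseteq> V" using z AR QR R by (auto simp: Y_def)
  have "card Y \<le> Suc (card (A ` C \<union> Q))" unfolding Y_def by (rule card_insert_le_m1[of "Suc _", simplified]) auto
  also have "\<dots> \<le> Suc (card (A ` C) + card Q)" using card_Un_le by auto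
  also have "\<dots> \<le> Suc (l + 2 * l)"
    using card_image_le[of C A] n_le[OF i] cardQ by (auto simp: C_def)
  also have "\<dots> \<le> 3 * (l + 1)\<^sup>2" by (simp add: power2_eq_square)
  finally obtain j \<psi> where j: "j \<in> I" and \<psi>: "colouring j H Y \<psi>"
    using locally_colourableD(2)[OF lc YV] by blast
  have AY: "A ` {..<n i} \<subseteq> Y" by (auto simp: Y_def C_def)
  note cc = colouring_of_copy[OF i j \<psi> AY copy]
  let ?\<sigma> = "\<psi> \<circ> A"
  have \<psi>': "colouring i H Y \<psi>" using \<psi> cc(1) by simp
  have "\<psi> z \<in> ?\<sigma> ` {..<n i}" using \<psi>' cc(2) by (auto simp: colouring_def bij_betw_def Y_def)
  then obtain a where a: "a < n i" "\<psi> z = ?\<sigma> a" by auto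
  note ga = g[OF a(1)]
  have col: "\<psi> y = ?\<sigma> (c y)" if "y \<in> g a - {z}" for y
  proof -
    have yQ: "y \<in> Q" using that a by (auto simp: Q_def C_def)
    then have "c y < n i" using cR QR by (auto simp: C_def)
    moreover have "A b' \<noteq> y" if "b' < n i" "b' \<noteq> c y" for b' using cA[of b'] that by (auto simp: C_def)
    ultimately show ?thesis
      using colour_of_attached[OF H i \<psi>' AY cc(2), of y "c y"] yQ attached[OF yQ] by (auto simp: Y_def)
  qed
  have "g a \<subseteq> Y" using a by (auto simp: Y_def Q_def C_def)
  then have "\<psi> ` g a \<in> E i" using ga \<psi>' by (auto simp: colouring_def)
  moreover have "\<psi> ` g a = ?\<sigma> ` insert a (c ` (g a - {z}))"
  proof -
    have "\<psi> ` g a = insert (\<psi> z) (\<psi> ` (g a - {z}))" using ga by auto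
    also have "\<psi> ` (g a - {z}) = ?\<sigma> ` c ` (g a - {z})" using col by (auto simp: image_image)
    finally show ?thesis using a by simp
  qed
  moreover have "insert a (c ` (g a - {z})) \<subseteq> {..<n i}" using a ga cR by (auto simp: C_def)
  ultimately have "insert a (c ` (g a - {z})) \<in> E i" using cc(3) by metis
  then show False using ga by blast
qed

corollary colour_new_vertex:
  assumes lc: "locally_colourable V H" and w: "subweight V w" and R: "R \<subseteq> V"
    and near: "wt H w \<ge> lam - s\<^sup>2" and rest: "sum w (V - R) \<le> \<rho>"
    and small: "s\<^sup>2 + \<rho> \<le> \<theta>\<^sup>2" "\<rho> \<le> \<theta>"
    and big: "\<And>y. y \<in> R \<Longrightarrow> wt (link y H) w \<ge> 3 * lam - \<theta>"
    and i: "i \<in> I" and c: "colouring i H R c" and z: "z \<in> V" "z \<notin> R"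
  shows "\<exists>c. colouring i H (insert z R) c"
proof -
  obtain a where a: "a < n i"
      "\<And>e. e \<in> H \<Longrightarrow> z \<in> e \<Longrightarrow> e - {z} \<subseteq> R \<Longrightarrow> insert a (c ` (e - {z})) \<in> E i"
    using extend_colouring[OF lc w R near rest small big i c z(1)] by blast
  have "colouring i H (insert z R) (c(z := a))"
    unfolding colouring_def
  proof (intro conjI ballI impI)
    show "(c(z := a)) ` insert z R \<subseteq> {..<n i}" using a(1) c by (auto simp: colouring_def)
    fix e assume e: "e \<in> H" "e \<subseteq> insert z R"
    show "(c(z := a)) ` e \<in> E i"
    proof (cases "z \<in> e")
      case True
      then have "(c(z := a)) ` e = insert a ((c(z := a)) ` (e - {z}))" by auto
      also have "(c(z := a)) ` (e - {z}) = c ` (e - {z})" by (intro image_cong) auto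
      finally show ?thesis using a(2)[OF e(1) True] e(2) by auto
    next
      case False
      then have "(c(z := a)) ` e = c ` e" by (intro image_cong) auto
      moreover have "e \<subseteq> R" using e(2) False by auto
      ultimately show ?thesis using e(1) c by (simp add: colouring_def)
    qed
  qed
  then show ?thesis by blast
qed

end

subsection \<open>Symmetrisation\<close>

definition move :: "'a \<Rightarrow> 'a \<Rightarrow> ('a \<Rightarrow> real) \<Rightarrow> 'a \<Rightarrow> real" where
  "move u v w = (w(u := 0))(v := w v + w u)"

lemma sum_move:
  assumes "finite V" "u \<in> V" "v \<in> V" "u \<noteq> v"
  shows "sum (move u v w) V = sum w V"
proof -
  have "sum w' V = w' u + (w' v + sum w' (V - {u} - {v}))" for w' :: "'a \<Rightarrow> real"
    using assms by (subst sum.remove[of V u], simp_all, subst sum.remove[of "V - {u}" v]) auto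
  moreover have "sum (move u v w) (V - {u} - {v}) = sum w (V - {u} - {v})"
    by (intro sum.cong) (auto simp: move_def)
  ultimately show ?thesis using assms(4) by (simp add: move_def)
qed

lemma subweight_move:
  assumes "subweight V w" "finite V" "u \<in> V" "v \<in> V" "u \<noteq> v"
  shows "subweight V (move u v w)"
  using assms(1) sum_move[OF assms(2-5), of w] assms(3-5)
  unfolding subweight_def by (auto simp: move_def)

text \<open>No edge contains both vertices, so the weight is linear along the move.\<close>

lemma wt_move:
  assumes H: "uniform 3 V H" and w: "subweight V w" and uv: "u \<in> V" "u \<noteq> v"
    and unc: "\<not> (\<exists>e\<in>H. u \<in> e \<and> v \<in> e)" and le: "wt (link u H) w \<le> wt (link v H) w"
  shows "wt H w \<le> wt H (move u v w)"
proof -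
  have "wt (link v H) (w(u := 0)) = wt (link v H) w"
    unfolding wt_link using unc by (intro sum.cong prod.cong) auto
  then have "wt H (move u v w) = wt H w - w u * wt (link u H) w + w u * wt (link v H) w"
    using wt_update[OF H, of "w(u := 0)" v "w v + w u"] wt_update[OF H, of w u 0] uv(2)
    by (simp add: move_def)
  moreover have "w u * wt (link u H) w \<le> w u * wt (link v H) w"
    using le subweightD(1)[OF w uv(1)] by (rule mult_left_mono)
  ultimately show ?thesis by linarith
qed

text \<open>Each move removes a vertex from the support. The process ends when any two vertices of the
  support lie in a common edge.\<close>

lemma symmetrisation_induct [consumes 2, case_names covered move]:
  assumes H: "uniform 3 V H" and "subweight V w"
    and covered: "\<And>w. subweight V w \<Longrightarrow>
      (\<And>u v. u \<in> V \<Longrightarrow> v \<in> V \<Longrightarrow> 0 < w u \<Longrightarrow> 0 < w v \<Longrightarrow> u \<noteq> v \<Longrightarrow> \<exists>e\<in>H. u \<in> e \<and> v \<in> e) \<Longrightarrow> P w"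
    and move: "\<And>w u v. subweight V w \<Longrightarrow> u \<in> V \<Longrightarrow> v \<in> V \<Longrightarrow> 0 < w u \<Longrightarrow> 0 < w v \<Longrightarrow> u \<noteq> v \<Longrightarrow>
      wt (link u H) w \<le> wt (link v H) w \<Longrightarrow> wt H w \<le> wt H (move u v w) \<Longrightarrow>
      subweight V (move u v w) \<Longrightarrow> P (move u v w) \<Longrightarrow> P w"
  shows "P w"
  using assms(2)
proof (induction "card {x \<in> V. 0 < w x}" arbitrary: w rule: less_induct)
  case less
  note fV = uniformD(1)[OF H]
  show ?case
  proof (cases "\<forall>u\<in>V. \<forall>v\<in>V. 0 < w u \<longrightarrow> 0 < w v \<longrightarrow> u \<noteq> v \<longrightarrow> (\<exists>e\<in>H. u \<in> e \<and> v \<in> e)")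
    case True
    then show ?thesis using covered[OF less.prems] by blast
  next
    case False
    then obtain u v where uv: "u \<in> V" "v \<in> V" "0 < w u" "0 < w v" "u \<noteq> v" "\<not> (\<exists>e\<in>H. u \<in> e \<and> v \<in> e)"
      and le: "wt (link u H) w \<le> wt (link v H) w"
      by (metis linear)
    have "{x \<in> V. 0 < move u v w x} \<subset> {x \<in> V. 0 < w x}"
      using uv by (auto simp: move_def split: if_splits)
    then have "card {x \<in> V. 0 < move u v w x} < card {x \<in> V. 0 < w x}"
      using fV by (intro psubset_card_mono) auto
    moreover have sub: "subweight V (move u v w)" using subweight_move[OF less.prems fV] uv by blast
    ultimately have "P (move u v w)" by (rule less.hyps)
    then show ?thesis using move[OF less.prems uv(1-5) le _ sub] wt_move[OF H less.prems _ _ _ le] uv by blast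
  qed
qed

context pattern_family
begin

text \<open>A support with more than \<^term>\<open>l\<close> vertices would contain \<^term>\<open>l + 1\<close> vertices which,
  together with edges covering their pairs, span boundedly many vertices; these vertices would need
  pairwise distinct colours.\<close>

lemma covered_set_colourable:
  assumes lc: "locally_colourable V H" and S: "S \<subseteq> V"
    and cov: "\<And>u v. u \<in> S \<Longrightarrow> v \<in> S \<Longrightarrow> u \<noteq> v \<Longrightarrow> \<exists>e\<in>H. u \<in> e \<and> v \<in> e"
  shows "\<exists>i\<in>I. \<exists>c. colouring i H S c"
proof (cases "card S \<le> l")
  case True
  also have "l \<le> 3 * (l + 1)\<^sup>2" by (simp add: power2_eq_square)
  finally show ?thesis by (rule locally_colourableD(2)[OF lc S])
next
  case False
  note H = locally_colourableD(1)[OF lc]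
  from False obtain T where T: "T \<subseteq> S" "card T = l + 1" "finite T"
    using obtain_subset_with_card_n[of "l + 1" S] by (metis Suc_eq_plus1 not_less_eq_eq)
  obtain g where g: "\<And>u v. u \<in> S \<Longrightarrow> v \<in> S \<Longrightarrow> u \<noteq> v \<Longrightarrow> g u v \<in> H \<and> u \<in> g u v \<and> v \<in> g u v"
    using cov by metis
  define G where "G p = (if fst p = snd p then {fst p} else g (fst p) (snd p))" for p
  define X where "X = (\<Union>p\<in>T \<times> T. G p)"
  have edge: "g (fst p) (snd p) \<in> H" if "p \<in> T \<times> T" "fst p \<noteq> snd p" for p
  proof -
    have "fst p \<in> S" "snd p \<in> S" using that(1) T(1) by auto
    then show ?thesis using g that(2) by blast
  qed
  have "G p \<subseteq> V" if "p \<in> T \<times> T" for p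
    using edge[OF that] uniformD(3)[OF H] that T(1) S by (auto simp: G_def)
  then have "X \<subseteq> V" unfolding X_def by blast
  moreover have "card X \<le> 3 * (l + 1)\<^sup>2"
  proof -
    have "card X \<le> (\<Sum>p\<in>T \<times> T. card (G p))" unfolding X_def by (rule card_UN_le) (simp add: T)
    also have "\<dots> \<le> (\<Sum>p\<in>T \<times> T. 3)"
    proof (rule sum_mono)
      fix p assume "p \<in> T \<times> T"
      then show "card (G p) \<le> 3" using edge uniformD(4)[OF H] by (auto simp: G_def)
    qed
    also have "\<dots> = 3 * (l + 1)\<^sup>2" using T by (simp add: card_cartesian_product power2_eq_square)
    finally show ?thesis .
  qed
  ultimately obtain j \<psi> where j: "j \<in> I" and \<psi>: "colouring j H X \<psi>"
    using locally_colourableD(2)[OF lc] by blast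
  have "inj_on \<psi> T"
  proof (rule inj_onI, rule ccontr)
    fix u v assume uv: "u \<in> T" "v \<in> T" "\<psi> u = \<psi> v" "u \<noteq> v"
    then have e: "g u v \<in> H" "u \<in> g u v" "v \<in> g u v" using g T(1) by blast+
    have "G (u, v) \<subseteq> X" using uv unfolding X_def by blast
    then have "g u v \<subseteq> X" using uv(4) by (simp add: G_def)
    then have "inj_on \<psi> (g u v)"
      using edges_in_blowup[OF H j \<psi>] e by (auto simp: blowup_def)
    then show False using e uv by (auto dest: inj_onD)
  qed
  moreover have "T \<subseteq> X" unfolding X_def G_def by force
  then have "\<psi> ` T \<subseteq> {..<n j}" using \<psi> by (auto simp: colouring_def)
  ultimately have "card T \<le> n j" using card_inj_on_le[of \<psi> T "{..<n j}"] by simp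
  then show ?thesis using T n_le[OF j] by simp
qed

lemma wt_colourable_le:
  assumes H: "uniform 3 V H" and w: "subweight V w" and i: "i \<in> I" and c: "colouring i H S c"
    and S: "S \<subseteq> V" "\<And>x. x \<in> V - S \<Longrightarrow> w x = 0"
  shows "wt H w \<le> lam"
proof -
  have "wt H w \<le> wt {e \<in> H. e \<subseteq> S} w + sum w (V - S)"
    using wt_restrict[of 2 V H w S] H w S(1) by (simp add: numeral_3_eq_3)
  moreover have "sum w (V - S) = 0" using S(2) by (intro sum.neutral) auto
  moreover have fS: "finite S" using S(1) uniformD(1)[OF H] by (rule finite_subset)
  have wS: "subweight S w" using subweight_subset[OF w uniformD(1)[OF H] S(1)] .
  have "wt {e \<in> H. e \<subseteq> S} w \<le> wt (blowup c S (E i)) w"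
    by (rule wt_mono[OF uniform_blowup[OF patternD(1)[OF pat[OF i]] fS] wS edges_in_blowup[OF H i c]])
  moreover have "\<dots> \<le> lam"
    unfolding wt_blowup[OF patternD(1)[OF pat[OF i]] fS]
    using subweight_fibre[OF wS fS, of "{..<n i}" c] c
    by (intro pattern_le[OF pat[OF i]]) (auto simp: colouring_def)
  ultimately show ?thesis by linarith
qed

lemma wt_le_lam:
  assumes lc: "locally_colourable V H" and w: "subweight V w"
  shows "wt H w \<le> lam"
proof -
  note H = locally_colourableD(1)[OF lc]
  from H w show ?thesis
  proof (induction rule: symmetrisation_induct)
    case (covered w)
    let ?S = "{x \<in> V. 0 < w x}"
    obtain i c where "i \<in> I" "colouring i H ?S c"
      using covered_set_colourable[OF lc, of ?S] covered(2) by auto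
    then show ?case
      using subweightD(1)[OF covered(1)] by (intro wt_colourable_le[OF H covered(1)]) (auto simp: less_le)
  next
    case (move w u v)
    then show ?case by linarith
  qed
qed

text \<open>Vertices of weight zero are left out, so that the core of a weighting with small support is
  small as well.\<close>

definition core :: "'a set \<Rightarrow> 'a set set \<Rightarrow> ('a \<Rightarrow> real) \<Rightarrow> 'a set" where
  "core V H w = {v \<in> V. 0 < w v \<and> wt (link v H) w \<ge> 3 * lam - \<theta>}"

text \<open>The hypotheses of \<open>colour_new_vertex\<close> persist while the coloured set grows within the core, so
  the remaining vertices are coloured one by one.\<close>

lemma colour_core:
  assumes lc: "locally_colourable V H" and w: "subweight V w"
    and near: "wt H w \<ge> lam - s\<^sup>2" and small: "s\<^sup>2 + \<rho> \<le> \<theta>\<^sup>2" "\<rho> \<le> \<theta>"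
    and i: "i \<in> I" and c: "colouring i H R c" and R: "R \<subseteq> core V H w" "sum w (V - R) \<le> \<rho>"
  shows "\<exists>c. colouring i H (core V H w) c"
proof -
  note H = locally_colourableD(1)[OF lc]
  have fV: "finite V" using H by (rule uniformD)
  have coreV: "core V H w \<subseteq> V" by (auto simp: core_def)
  have fin: "finite (core V H w - R)" using fV coreV by (auto intro: finite_subset)
  have "\<exists>c. colouring i H (R \<union> F) c" if "F \<subseteq> core V H w - R" for F
    using finite_subset[OF that fin] that
  proof (induction F rule: finite_induct)
    case empty
    then show ?case using c by auto
  next
    case (insert z F)
    then obtain c' where c': "colouring i H (R \<union> F) c'" by auto
    have RF: "R \<union> F \<subseteq> core V H w" "z \<in> V" "z \<notin> R \<union> F" using R insert coreV by auto
    have "sum w (V - (R \<union> F)) \<le> sum w (V - R)"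
      using fV subweightD(1)[OF w] by (intro sum_mono2) auto
    then have "sum w (V - (R \<union> F)) \<le> \<rho>" using R by linarith
    moreover have "wt (link y H) w \<ge> 3 * lam - \<theta>" if "y \<in> R \<union> F" for y
      using that RF(1) by (auto simp: core_def)
    moreover have "R \<union> F \<subseteq> V" using RF(1) coreV by blast
    ultimately show ?case
      using colour_new_vertex[OF lc w _ near _ small _ i c' RF(2,3)] by simp
  qed
  from this[of "core V H w - R"] R show ?thesis by (simp add: Un_absorb1)
qed

lemma core_weight:
  assumes "locally_colourable V H" "subweight V w" "wt H w \<ge> lam - s\<^sup>2" "0 < s" "s \<le> 1/4"
  shows "sum w (V - core V H w) \<le> 5 * s / \<theta>"
  unfolding core_def
  using small_link_weight[OF locally_colourableD(1)[OF assms(1)] assms(2) wt_le_lam[OF assms(1)] lam assms(4,5,3) \<theta>(1)] .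

text \<open>Follow the symmetrisation backwards. Undoing a single move, the two cores differ only in a
  set of small weight and possibly in \<^term>\<open>u\<close>; but the colouring of
  their intersection extends to every further vertex, in particular to \<^term>\<open>u\<close>.
  That the mass moves towards the vertex with the larger derivative ensures that a heavy \<^term>\<open>v\<close>
  cannot drop out of the core.\<close>

theorem core_colourable:
  assumes lc: "locally_colourable V H" and w: "subweight V w"
    and near: "wt H w \<ge> lam - (\<theta>^3 / 30)\<^sup>2"
  shows "\<exists>i\<in>I. \<exists>c. colouring i H (core V H w) c"
proof -
  note H = locally_colourableD(1)[OF lc]
  have fV: "finite V" using H by (rule uniformD)
  define s where "s = \<theta>^3 / 30"
  \<comment> \<open>The bound of \<open>core_weight\<close>. The cube in \<^term>\<open>s\<close> turns it into a multiple of \<^term>\<open>\<theta>\<^sup>2\<close>, small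
    enough for the uncoloured part to be three times as heavy.\<close>
  define \<kappa> where "\<kappa> = 5 * s / \<theta>"
  have \<kappa>: "\<kappa> = \<theta>\<^sup>2 / 6" using \<theta>(1) by (simp add: \<kappa>_def s_def power2_eq_square power3_eq_cube)
  have \<theta>1: "\<theta> \<le> 1" using \<theta>(2) by simp
  have "\<theta>^3 \<le> 1^3" using \<theta>(1) \<theta>1 by (intro power_mono) auto
  then have s: "0 < s" "s \<le> 1/4" using \<theta>(1) by (auto simp: s_def)
  have "s\<^sup>2 \<le> s" using s by (simp add: power2_eq_square)
  also have "s \<le> \<theta>\<^sup>2 / 30"
    using \<theta>(1) \<theta>1 mult_left_mono[of \<theta> 1 "\<theta>\<^sup>2"] by (simp add: s_def power2_eq_square power3_eq_cube)
  finally have "s\<^sup>2 \<le> \<theta>\<^sup>2 / 30" .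
  then have small: "s\<^sup>2 + 3 * \<kappa> \<le> \<theta>\<^sup>2" using \<kappa> zero_le_power2[of \<theta>] by linarith
  have "\<theta>\<^sup>2 \<le> \<theta>" using \<theta>(1) \<theta>1 by (simp add: power2_eq_square)
  then have small2: "3 * \<kappa> \<le> \<theta>" using \<kappa> \<theta>(1) by linarith
  have \<kappa>0: "0 \<le> \<kappa>" unfolding \<kappa> by simp
  have weight: "sum w (V - core V H w) \<le> \<kappa>" if "subweight V w" "wt H w \<ge> lam - s\<^sup>2" for w
    unfolding \<kappa>_def by (rule core_weight[OF lc that s])
  from H w near[folded s_def] show ?thesis
  proof (induction rule: symmetrisation_induct)
    case (covered w)
    have "core V H w \<subseteq> V" by (auto simp: core_def)
    moreover have "\<exists>e\<in>H. u \<in> e \<and> v \<in> e" if "u \<in> core V H w" "v \<in> core V H w" "u \<noteq> v" for u v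
      using that by (intro covered(2)) (auto simp: core_def)
    ultimately show ?case by (rule covered_set_colourable[OF lc])
  next
    case (move w u v)
    let ?w' = "move u v w"
    have near': "wt H ?w' \<ge> lam - s\<^sup>2" using move.prems move.hyps(8) by linarith
    then obtain i c where i: "i \<in> I" and c: "colouring i H (core V H ?w') c" using move.IH by blast
    let ?D = "core V H w" and ?D' = "core V H ?w'"
    define R where "R = ?D \<inter> ?D'"
    have w0: "0 \<le> w x" and w'0: "0 \<le> ?w' x" if "x \<in> V" for x
      using that subweightD(1)[OF move.hyps(1)] subweightD(1)[OF move.hyps(9)] by auto
    note le\<kappa> = weight[OF move.hyps(1) move.prems] and le\<kappa>' = weight[OF move.hyps(9) near']
    have "sum ?w' (V - ?D) \<le> sum w (V - ?D)"
    proof (cases "v \<in> ?D")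
      case True
      then show ?thesis using w0 by (intro sum_mono) (auto simp: move_def)
    next
      case False
      then have "u \<notin> ?D" using move.hyps(2-5,7) by (auto simp: core_def)
      then show ?thesis using False move.hyps(2,3,6) fV by (subst sum_move) auto
    qed
    then have D: "sum ?w' (V - ?D) \<le> \<kappa>" using le\<kappa> by linarith
    have "sum ?w' (V - R) \<le> sum ?w' (V - ?D) + sum ?w' (V - ?D')"
    proof -
      have "V - R = (V - ?D) \<union> (V - ?D')" by (auto simp: R_def)
      moreover have "0 \<le> sum ?w' ((V - ?D) \<inter> (V - ?D'))" using w'0 by (intro sum_nonneg) auto
      ultimately show ?thesis
        using sum.union_inter[of "V - ?D" "V - ?D'" ?w'] fV by simp
    qed
    then have R: "sum ?w' (V - R) \<le> 2 * \<kappa>" using D le\<kappa>' by linarith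
    have cR: "colouring i H R c" using c by (rule colouring_subset) (simp add: R_def)
    have RV: "R \<subseteq> V" by (auto simp: R_def core_def)
    have uR: "u \<notin> R" using move.hyps(6) by (auto simp: R_def core_def move_def)
    have R2: "sum w (V - R - {u}) \<le> 2 * \<kappa>"
    proof -
      have "sum w (V - R - {u}) \<le> sum ?w' (V - R - {u})"
        using w0 move.hyps(2) by (intro sum_mono) (auto simp: move_def)
      also have "\<dots> \<le> sum ?w' (V - R)" using fV w'0 by (intro sum_mono2) auto
      finally show ?thesis using R by linarith
    qed
    have "\<exists>R' c'. R' \<subseteq> ?D \<and> sum w (V - R') \<le> 3 * \<kappa> \<and> colouring i H R' c'"
    proof (cases "u \<in> ?D")
      case True
      have sm: "s\<^sup>2 + 2 * \<kappa> \<le> \<theta>\<^sup>2" "2 * \<kappa> \<le> \<theta>" using small small2 \<kappa>0 by auto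
      have big: "3 * lam - \<theta> \<le> wt (link y H) ?w'" if "y \<in> R" for y
        using that by (auto simp: R_def core_def)
      have "\<exists>c. colouring i H (insert u R) c"
        using colour_new_vertex[OF lc move.hyps(9) RV near' R sm big i cR move.hyps(2) uR] by blast
      moreover have "V - insert u R = V - R - {u}" by auto
      ultimately show ?thesis using True R2 \<kappa>0 by (intro exI[of _ "insert u R"]) (auto simp: R_def)
    next
      case False
      have "sum w (V - R) = w u + sum w (V - R - {u})" using uR move.hyps(2) fV by (intro sum.remove) auto
      moreover have "w u \<le> sum w (V - ?D)" using False move.hyps(2) fV w0 by (intro member_le_sum) auto
      ultimately have "sum w (V - R) \<le> 3 * \<kappa>" using R2 le\<kappa> by linarith
      then show ?thesis using cR by (intro exI[of _ R] exI[of _ c]) (auto simp: R_def)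
    qed
    then obtain R' c' where R': "R' \<subseteq> ?D" "sum w (V - R') \<le> 3 * \<kappa>" "colouring i H R' c'" by blast
    then show ?case using colour_core[OF lc move.hyps(1) move.prems small small2 i R'(3,1,2)] i by blast
  qed
qed

end

section \<open>Patterns with a common density\<close>

definition complete :: "nat \<Rightarrow> 'a set \<Rightarrow> 'a set set" where
  "complete r C = {e. e \<subseteq> C \<and> card e = r}"

lemma uniform_complete: "finite C \<Longrightarrow> uniform r C (complete r C)"
  by (auto simp: uniform_def complete_def)

lemma link_complete:
  assumes "finite C" "v \<in> C"
  shows "link v (complete (Suc r) C) = complete r (C - {v})"
proof
  show "link v (complete (Suc r) C) \<subseteq> complete r (C - {v})"
    by (auto simp: link_def complete_def card_Diff_singleton)
  show "complete r (C - {v}) \<subseteq> link v (complete (Suc r) C)"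
  proof
    fix e assume e: "e \<in> complete r (C - {v})"
    then have "finite e" "v \<notin> e" using assms(1) by (auto simp: complete_def intro: finite_subset)
    then have "insert v e \<in> complete (Suc r) C" "e = insert v e - {v}"
      using e assms(2) by (auto simp: complete_def)
    then show "e \<in> link v (complete (Suc r) C)" unfolding link_def by blast
  qed
qed

lemma wt_complete_1: "finite C \<Longrightarrow> wt (complete 1 C) w = sum w C"
proof -
  have "complete 1 C = (\<lambda>x. {x}) ` C" by (auto simp: complete_def card_1_singleton_iff)
  then show ?thesis by (simp add: wt_def sum.reindex)
qed

lemma wt_complete_2:
  assumes "finite C"
  shows "2 * wt (complete 2 C) w = (sum w C)\<^sup>2 - (\<Sum>v\<in>C. (w v)\<^sup>2)"
proof -
  have "2 * wt (complete 2 C) w = (\<Sum>v\<in>C. w v * wt (link v (complete 2 C)) w)"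
    using sum_weight_link[OF uniform_complete[OF assms, of 2], of w] by simp
  also have "\<dots> = (\<Sum>v\<in>C. w v * (sum w C - w v))"
  proof (rule sum.cong)
    fix v assume v: "v \<in> C"
    have "link v (complete 2 C) = complete 1 (C - {v})"
      using link_complete[OF assms v, of 1] by (simp add: numeral_2_eq_2)
    then have "wt (link v (complete 2 C)) w = sum w (C - {v})" using assms by (simp only: wt_complete_1 finite_Diff)
    then show "w v * wt (link v (complete 2 C)) w = w v * (sum w C - w v)"
      using assms v by (simp add: sum_diff1)
  qed simp
  also have "\<dots> = (sum w C)\<^sup>2 - (\<Sum>v\<in>C. (w v)\<^sup>2)"
    by (simp add: right_diff_distrib sum_subtractf power2_eq_square sum_distrib_right)
  finally show ?thesis .
qed

lemma wt_complete_3: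
  assumes fin: "finite C" and one: "sum w C = 1"
  shows "6 * wt (complete 3 C) w = 1 - 3 * (\<Sum>v\<in>C. (w v)\<^sup>2) + 2 * (\<Sum>v\<in>C. (w v)^3)"
proof -
  define p where "p = (\<Sum>v\<in>C. (w v)\<^sup>2)"
  have "6 * wt (complete 3 C) w = (\<Sum>v\<in>C. w v * (2 * wt (link v (complete 3 C)) w))"
    using sum_weight_link[OF uniform_complete[OF fin, of 3], of w]
    by (simp add: mult.left_commute[of _ 2] flip: sum_distrib_left)
  also have "\<dots> = (\<Sum>v\<in>C. w v * (1 - p) + (2 * (w v)^3 - 2 * (w v)\<^sup>2))"
  proof (rule sum.cong)
    fix v assume v: "v \<in> C"
    have "link v (complete 3 C) = complete 2 (C - {v})"
      using link_complete[OF fin v, of 2] by (simp add: numeral_3_eq_3)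
    then have eq: "2 * wt (link v (complete 3 C)) w = (1 - w v)\<^sup>2 - (p - (w v)\<^sup>2)"
      using wt_complete_2[of "C - {v}" w] fin v one by (simp add: sum_diff1 p_def)
    then show "w v * (2 * wt (link v (complete 3 C)) w) = w v * (1 - p) + (2 * (w v)^3 - 2 * (w v)\<^sup>2)"
      unfolding eq by (simp add: power2_eq_square power3_eq_cube algebra_simps)
  qed simp
  also have "\<dots> = sum w C * (1 - p) + 2 * (\<Sum>v\<in>C. (w v)^3) - 2 * p"
    by (simp add: sum.distrib sum_subtractf sum_distrib_left p_def flip: sum_distrib_right)
  finally show ?thesis using one by (simp add: p_def)
qed

text \<open>Every vertex has degree \<^term>\<open>d\<close>, phrased as the double counting identity in which it is used;
  an indicator function in place of \<open>g\<close> gives back the degree.\<close>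

definition regular :: "nat \<Rightarrow> nat \<Rightarrow> nat set set \<Rightarrow> bool" where
  "regular d n S \<longleftrightarrow> uniform 3 {..<n} S \<and> (\<forall>g :: nat \<Rightarrow> real. (\<Sum>e\<in>S. \<Sum>b\<in>e. g b) = real d * (\<Sum>b<n. g b))"

text \<open>Deviations \<^term>\<open>x\<close> from the uniform distribution lower the weight of a triple at most
  quadratically, after the linear terms; these cancel when summed over a regular system.\<close>

lemma triple_lower_bound:
  fixes h x y z :: real
  assumes "0 \<le> h" "- h \<le> x" "- h \<le> y" "- h \<le> z"
  shows "(h + x) * (h + y) * (h + z) \<ge> h^3 + h\<^sup>2 * (x + y + z) - h * (x\<^sup>2 + y\<^sup>2 + z\<^sup>2)"
proof -
  have cubic: "x * y * z \<ge> - (h / 2) * (x\<^sup>2 + y\<^sup>2 + z\<^sup>2)"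
    if "- h \<le> x" "- h \<le> y" "- h \<le> z" for x y z :: real
  proof -
    \<comment> \<open>Two of the three deviations have a non-negative product, and the third is at least \<^term>\<open>- h\<close>.\<close>
    have one: "a * b * c \<ge> - (h / 2) * (a\<^sup>2 + b\<^sup>2 + c\<^sup>2)" if "0 \<le> a * b" "- h \<le> c" for a b c :: real
    proof -
      have "- h * (a * b) \<le> c * (a * b)" using that by (intro mult_right_mono) auto
      moreover have "h * (2 * (a * b)) \<le> h * (a\<^sup>2 + b\<^sup>2 + c\<^sup>2)"
        using assms(1) sum_squares_bound[of a b] by (intro mult_left_mono) (auto simp: add_increasing2)
      ultimately show ?thesis by (simp add: algebra_simps)
    qed
    have "0 \<le> x * y \<or> 0 \<le> y * z \<or> 0 \<le> z * x"
      by (simp add: zero_le_mult_iff) linarith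
    then show ?thesis
      using one[of x y z] one[of y z x] one[of z x y] that by (auto simp: algebra_simps)
  qed
  have "0 \<le> h * (x + y + z)\<^sup>2" using assms(1) by simp
  then have "h * (x * y + y * z + z * x) \<ge> - (h / 2) * (x\<^sup>2 + y\<^sup>2 + z\<^sup>2)"
    by (simp add: power2_eq_square algebra_simps)
  with cubic[OF assms(2-4)] show ?thesis
    by (simp add: power2_eq_square power3_eq_cube algebra_simps)
qed

lemma regular_lower_bound:
  assumes S: "regular d n S" and n: "0 < n" and \<alpha>: "\<And>b. b < n \<Longrightarrow> 0 \<le> \<alpha> b" "sum \<alpha> {..<n} = 1"
  shows "wt S \<alpha> \<ge> real (card S) / real n ^ 3 - real d / real n * (\<Sum>b<n. (\<alpha> b - 1 / real n)\<^sup>2)"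
proof -
  define h where "h = 1 / real n"
  define x where "x b = \<alpha> b - h" for b
  have uS: "uniform 3 {..<n} S" and reg: "\<And>g :: nat \<Rightarrow> real. (\<Sum>e\<in>S. \<Sum>b\<in>e. g b) = real d * (\<Sum>b<n. g b)"
    using S by (auto simp: regular_def)
  have sumx: "(\<Sum>b<n. x b) = 0" using \<alpha>(2) n by (simp add: x_def sum_subtractf h_def)
  have "real (card S) * h^3 + h\<^sup>2 * (real d * (\<Sum>b<n. x b)) - h * (real d * (\<Sum>b<n. (x b)\<^sup>2))
      = (\<Sum>e\<in>S. h^3 + h\<^sup>2 * (\<Sum>b\<in>e. x b) - h * (\<Sum>b\<in>e. (x b)\<^sup>2))"
    by (simp add: sum.distrib sum_subtractf reg flip: sum_distrib_left)
  also have "\<dots> \<le> wt S \<alpha>"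
    unfolding wt_def
  proof (rule sum_mono)
    fix e assume e: "e \<in> S"
    then obtain a b c where abc: "e = {a, b, c}" "a \<noteq> b" "b \<noteq> c" "a \<noteq> c"
      using uniformD(4)[OF uS e] unfolding card_3_iff by blast
    then have "a < n" "b < n" "c < n" using uniformD(3)[OF uS e] by auto
    then have "- h \<le> x a" "- h \<le> x b" "- h \<le> x c" using \<alpha>(1) by (auto simp: x_def)
    moreover have "0 \<le> h" by (simp add: h_def)
    ultimately have "h^3 + h\<^sup>2 * (x a + x b + x c) - h * ((x a)\<^sup>2 + (x b)\<^sup>2 + (x c)\<^sup>2) \<le> (h + x a) * (h + x b) * (h + x c)"
      by (rule triple_lower_bound[rotated])
    then show "h^3 + h\<^sup>2 * (\<Sum>b\<in>e. x b) - h * (\<Sum>b\<in>e. (x b)\<^sup>2) \<le> (\<Prod>b\<in>e. \<alpha> b)"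
      using abc by (simp add: x_def add.assoc mult.assoc)
  qed
  finally show ?thesis using sumx by (simp add: x_def h_def power_divide)
qed

text \<open>In the complete triple system the loss from an uneven distribution is quadratic with constant
  at least \<^term>\<open>1/6 - 2 / (3 * n) :: real\<close>. Removing a regular system lowers this constant by at most
  \<^term>\<open>d / n :: real\<close>, which leaves more than the \<^term>\<open>1/18 :: real\<close> demanded of a pattern.\<close>

lemma pattern_complement:
  assumes S: "regular d n S" and n: "24 \<le> n" and d: "18 * d \<le> n"
    and lam: "lam = (1 - 3 / real n + 2 / (real n)\<^sup>2) / 6 - real d / (3 * (real n)\<^sup>2)"
  shows "pattern lam n (complete 3 {..<n} - S)"
proof -
  let ?C = "{..<n}" and ?K = "complete 3 {..<n}"
  have uS: "uniform 3 ?C S" and reg: "\<And>g :: nat \<Rightarrow> real. (\<Sum>e\<in>S. \<Sum>b\<in>e. g b) = real d * (\<Sum>b<n. g b)"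
    using S by (auto simp: regular_def)
  have uK: "uniform 3 ?C ?K" by (simp add: uniform_complete)
  have uE: "uniform 3 ?C (?K - S)" using uK by (rule uniform_subset) auto
  have SK: "S \<subseteq> ?K" using uniformD(3,4)[OF uS] by (auto simp: complete_def)
  have wtE: "wt (?K - S) w = wt ?K w - wt S w" for w
    by (rule wt_diff[OF uniformD(2)[OF uK] SK])
  have n0: "0 < real n" using n by simp
  have cardS: "3 * real (card S) = real d * real n"
    using reg[of "\<lambda>_. 1"] uniformD(4)[OF uS] by simp
  have lamS: "lam = (1 - 3 / real n + 2 / (real n)\<^sup>2) / 6 - real (card S) / real n ^ 3"
    unfolding lam using cardS n0 by (simp add: field_simps power2_eq_square power3_eq_cube)
  have bound: "wt (?K - S) \<alpha> \<le> lam - 1/18 * (\<Sum>b<n. (\<alpha> b - 1 / real n)\<^sup>2)"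
    if \<alpha>: "\<forall>b<n. 0 \<le> \<alpha> b" "sum \<alpha> ?C = 1" for \<alpha>
  proof -
    define h where "h = 1 / real n"
    define x where "x b = \<alpha> b - h" for b
    define Q where "Q = (\<Sum>b<n. (x b)\<^sup>2)"
    have Q0: "0 \<le> Q" unfolding Q_def by (intro sum_nonneg) auto
    have h: "0 < h" "h \<le> 1/24" "real n * h = 1" using n by (auto simp: h_def field_simps)
    have sumx: "(\<Sum>b<n. x b) = 0" using \<alpha>(2) h(3) by (simp add: x_def sum_subtractf)
    have a2: "(\<alpha> b)\<^sup>2 = h\<^sup>2 + 2 * h * x b + (x b)\<^sup>2" for b
      by (simp add: x_def power2_eq_square algebra_simps)
    have a3: "(\<alpha> b)^3 = h^3 + 3 * h\<^sup>2 * x b + 3 * h * (x b)\<^sup>2 + (x b)^3" for b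
      by (simp add: x_def power2_eq_square power3_eq_cube algebra_simps)
    have nh: "real n * h\<^sup>2 = h" "real n * h^3 = h\<^sup>2"
      using h(3) by (simp_all add: power2_eq_square power3_eq_cube flip: mult.assoc)
    have "(\<Sum>b<n. (\<alpha> b)\<^sup>2) = real n * h\<^sup>2 + 2 * h * (\<Sum>b<n. x b) + Q"
      unfolding a2 by (simp add: sum.distrib Q_def sum_distrib_left)
    then have p2: "(\<Sum>b<n. (\<alpha> b)\<^sup>2) = h + Q" using sumx nh by simp
    have "(\<Sum>b<n. (\<alpha> b)^3) = real n * h^3 + 3 * h\<^sup>2 * (\<Sum>b<n. x b) + 3 * h * Q + (\<Sum>b<n. (x b)^3)"
      unfolding a3 by (simp add: sum.distrib Q_def sum_distrib_left)
    then have p3: "(\<Sum>b<n. (\<alpha> b)^3) = h\<^sup>2 + 3 * h * Q + (\<Sum>b<n. (x b)^3)" using sumx nh by simp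
    have "(\<Sum>b<n. (x b)^3) \<le> (\<Sum>b<n. (1 - h) * (x b)\<^sup>2)"
    proof (rule sum_mono)
      fix b assume b: "b \<in> ?C"
      then have "\<alpha> b \<le> sum \<alpha> ?C" using \<alpha>(1) by (intro member_le_sum) auto
      then have "x b \<le> 1 - h" using \<alpha>(2) by (simp add: x_def)
      then have "x b * (x b)\<^sup>2 \<le> (1 - h) * (x b)\<^sup>2" by (intro mult_right_mono) auto
      then show "(x b)^3 \<le> (1 - h) * (x b)\<^sup>2" by (simp add: power2_eq_square power3_eq_cube mult.assoc)
    qed
    then have "(\<Sum>b<n. (x b)^3) \<le> (1 - h) * Q" by (simp add: Q_def sum_distrib_left)
    then have "6 * wt ?K \<alpha> \<le> 1 - 3 * (h + Q) + 2 * (h\<^sup>2 + 3 * h * Q + (1 - h) * Q)"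
      using wt_complete_3[of ?C \<alpha>] \<alpha>(2) p2 p3 by simp
    also have "\<dots> = 1 - 3 * h + 2 * h\<^sup>2 - Q + 4 * (h * Q)" by (simp add: algebra_simps)
    finally have K: "6 * wt ?K \<alpha> \<le> 1 - 3 * h + 2 * h\<^sup>2 - Q + 4 * (h * Q)" .
    have "h * Q \<le> 1/24 * Q" using h Q0 by (intro mult_right_mono) auto
    moreover have "wt S \<alpha> \<ge> real (card S) / real n ^ 3 - real d / real n * Q"
      using regular_lower_bound[OF S _ _ \<alpha>(2)] \<alpha>(1) n by (simp add: Q_def x_def h_def)
    moreover have "real d / real n * Q \<le> 1/18 * Q"
      using d n0 Q0 by (intro mult_right_mono) (auto simp: field_simps)
    moreover have "lam = (1 - 3 * h + 2 * h\<^sup>2) / 6 - real (card S) / real n ^ 3"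
      unfolding lamS by (simp add: h_def power_divide)
    moreover have "k - t \<le> m - 1/18 * Q"
      if "hQ \<le> 1/24 * Q" "c - dQ \<le> t" "dQ \<le> 1/18 * Q" "m = p / 6 - c" "6 * k \<le> p - Q + 4 * hQ"
      for k t m hQ c dQ p :: real
      using that Q0 by linarith
    ultimately have "wt (?K - S) \<alpha> \<le> lam - 1/18 * Q" using K unfolding wtE by blast
    then show ?thesis by (simp add: Q_def x_def h_def)
  qed
  have card: "real (card (?K - S)) = lam * real n ^ 3"
  proof -
    have "real (card (?K - S)) * (1 / real n) ^ 3 = wt ?K (\<lambda>_. 1 / real n) - wt S (\<lambda>_. 1 / real n)"
      unfolding wtE[symmetric] by (rule wt_const[OF uE, symmetric])
    also have "wt S (\<lambda>_. 1 / real n) = real (card S) / real n ^ 3"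
      by (simp add: wt_const[OF uS] power_divide)
    also have "wt ?K (\<lambda>_. 1 / real n) = (1 - 3 / real n + 2 / (real n)\<^sup>2) / 6"
      using wt_complete_3[of ?C "\<lambda>_. 1 / real n"] n0 by (simp add: field_simps power2_eq_square power3_eq_cube)
    finally have "real (card (?K - S)) / real n ^ 3 = lam" by (simp add: lamS power_divide)
    then show ?thesis using n0 by (simp add: divide_eq_eq)
  qed
  have cover: "\<exists>e\<in>?K - S. u \<in> e \<and> v \<in> e" if uv: "u < n" "v < n" "u \<noteq> v" for u v
  proof (rule ccontr)
    assume neg: "\<not> ?thesis"
    let ?Z = "?C - {u, v}"
    have "{u, v, z} \<in> {e \<in> S. u \<in> e}" if "z \<in> ?Z" for z
    proof -
      have "{u, v, z} \<in> ?K" using that uv by (auto simp: complete_def)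
      then show ?thesis using neg by (metis DiffI insertCI mem_Collect_eq)
    qed
    moreover have "inj_on (\<lambda>z. {u, v, z}) ?Z" by (rule inj_onI) (auto simp: doubleton_eq_iff)
    ultimately have "card ?Z \<le> card {e \<in> S. u \<in> e}"
      using uniformD(2)[OF uS] by (intro card_inj_on_le[of "\<lambda>z. {u, v, z}"]) auto
    moreover have "real (card {e \<in> S. u \<in> e}) = real d"
    proof -
      have "real d = real d * (\<Sum>b<n. if b = u then 1 else 0)" using uv(1) by simp
      also have "\<dots> = (\<Sum>e\<in>S. \<Sum>b\<in>e. if b = u then 1 else 0)" by (rule reg[symmetric])
      also have "\<dots> = (\<Sum>e\<in>S. if u \<in> e then 1 else 0)"
        using uniformD(5)[OF uS] by (intro sum.cong) auto
      also have "\<dots> = real (card {e \<in> S. u \<in> e})"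
        using uniformD(2)[OF uS] by (simp add: sum.If_cases Int_def)
      finally show ?thesis by simp
    qed
    moreover have "card ?Z = n - 2" using uv by (simp add: card_Diff_subset)
    ultimately show False using d n by linarith
  qed
  show ?thesis unfolding pattern_def using uE n cover card bound by auto
qed

subsection \<open>A regular triple system of prescribed degree\<close>

text \<open>A circulant bipartite graph of degree \<^term>\<open>d\<close> between two copies of the residues modulo
  \<^term>\<open>q\<close>, the vertices of the second copy being doubled.\<close>

definition circulant :: "nat \<Rightarrow> nat \<Rightarrow> nat set set" where
  "circulant d q = (\<lambda>(j, x). {x, q + (x + j) mod q, 2 * q + (x + j) mod q}) ` ({..<d} \<times> {..<q})"

lemma add_mod_inj:
  fixes x y j q :: nat
  assumes "x < q" "y < q" "(x + j) mod q = (y + j) mod q"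
  shows "x = y"
proof -
  have "a = b" if "a \<le> b" "a < q" "b < q" "(b + j) mod q = (a + j) mod q" for a b :: nat
  proof -
    have "q dvd (b + j) - (a + j)" using that(1,4) mod_eq_dvd_iff_nat[of "a + j" "b + j" q] by simp
    then have "q dvd b - a" by simp
    moreover have "b - a < q" using that(3) by simp
    ultimately show ?thesis using that(1) dvd_imp_le[of q "b - a"] by linarith
  qed
  from this[of x y] this[of y x] assms show ?thesis by (cases "x \<le> y") auto
qed

lemma sum_rotate:
  fixes g :: "nat \<Rightarrow> real"
  shows "(\<Sum>x<q. g ((x + j) mod q)) = (\<Sum>x<q. g x)"
proof (cases "q = 0")
  case False
  have inj: "inj_on (\<lambda>x. (x + j) mod q) {..<q}"
  proof (rule inj_onI)
    fix x y assume xy: "x \<in> {..<q}" "y \<in> {..<q}" "(x + j) mod q = (y + j) mod q"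
    then show "x = y" by (intro add_mod_inj[of x q y j]) auto
  qed
  have "(\<lambda>x. (x + j) mod q) ` {..<q} = {..<q}" using False inj by (intro endo_inj_surj) auto
  then show ?thesis using sum.reindex[OF inj, of g] by simp
qed simp

lemma regular_circulant:
  assumes d: "d \<le> q"
  shows "regular d (3 * q) (circulant d q)"
proof -
  let ?f = "\<lambda>(j, x). {x, q + (x + j) mod q, 2 * q + (x + j) mod q}"
  let ?P = "{..<d} \<times> {..<q}"
  have inj: "inj_on ?f ?P"
  proof (rule inj_onI, clarify)
    fix j x j' x' assume *: "j < d" "x < q" "j' < d" "x' < q"
      and eq: "{x, q + (x + j) mod q, 2 * q + (x + j) mod q} = {x', q + (x' + j') mod q, 2 * q + (x' + j') mod q}"
    have lt: "(x + j) mod q < q" "(x' + j') mod q < q" using * by simp_all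
    have "x \<in> {x', q + (x' + j') mod q, 2 * q + (x' + j') mod q}" unfolding eq[symmetric] by simp
    then have x: "x = x'" using *(2) by auto
    have "q + (x + j) mod q \<in> {x', q + (x' + j') mod q, 2 * q + (x' + j') mod q}"
      unfolding eq[symmetric] by simp
    then consider "q + (x + j) mod q = x'" | "(x + j) mod q = (x' + j') mod q"
      | "(x + j) mod q = q + (x' + j') mod q" by auto
    then have "(x + j) mod q = (x + j') mod q"
      by cases (use *(4) lt x in linarith, use x in simp, use lt in linarith)
    then have "j = j'" using * d by (intro add_mod_inj[of j q j' x]) (auto simp: add.commute)
    then show "j = j' \<and> x = x'" using x by simp
  qed
  have dist: "x \<noteq> q + y" "x \<noteq> 2 * q + y" "q + y \<noteq> 2 * q + y" if "x < q" "y < q" for x y :: nat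
    using that by auto
  have uni: "uniform 3 {..<3 * q} (circulant d q)"
    unfolding uniform_def
  proof (intro conjI ballI)
    fix e assume "e \<in> circulant d q"
    then obtain j x where e: "x < q" "e = {x, q + (x + j) mod q, 2 * q + (x + j) mod q}"
      by (auto simp: circulant_def)
    have m: "(x + j) mod q < q" using e(1) by simp
    have "x < 3 * q" "q + (x + j) mod q < 3 * q" "2 * q + (x + j) mod q < 3 * q"
      using e(1) m by linarith+
    then show "e \<subseteq> {..<3 * q}" unfolding e(2) insert_subset lessThan_iff by blast
    show "card e = 3" unfolding e(2) using dist[OF e(1) m] by simp
  qed simp
  have "(\<Sum>e\<in>circulant d q. \<Sum>b\<in>e. g b) = real d * (\<Sum>b<3 * q. g b)" for g :: "nat \<Rightarrow> real"
  proof -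
    have "(\<Sum>e\<in>circulant d q. \<Sum>b\<in>e. g b) = (\<Sum>p\<in>?P. \<Sum>b\<in>?f p. g b)"
      unfolding circulant_def by (subst sum.reindex[OF inj]) simp
    also have "\<dots> = (\<Sum>(j, x)\<in>?P. g x + (g (q + (x + j) mod q) + g (2 * q + (x + j) mod q)))"
    proof (rule sum.cong[OF refl])
      fix p assume "p \<in> ?P"
      then obtain j x where p: "p = (j, x)" "x < q" by auto
      then have "(x + j) mod q < q" by simp
      then show "(\<Sum>b\<in>?f p. g b) = (case p of (j, x) \<Rightarrow> g x + (g (q + (x + j) mod q) + g (2 * q + (x + j) mod q)))"
        using dist[of x "(x + j) mod q"] p by simp
    qed
    also have "\<dots> = (\<Sum>j<d. (\<Sum>x<q. g x) + ((\<Sum>x<q. g (q + (x + j) mod q)) + (\<Sum>x<q. g (2 * q + (x + j) mod q))))"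
      by (simp add: sum.distrib flip: sum.cartesian_product)
    also have "\<dots> = (\<Sum>j<d. (\<Sum>x<q. g x) + ((\<Sum>x<q. g (q + x)) + (\<Sum>x<q. g (2 * q + x))))"
      using sum_rotate[of "\<lambda>y. g (q + y)"] sum_rotate[of "\<lambda>y. g (2 * q + y)"] by simp
    also have "\<dots> = real d * ((\<Sum>x<q. g x) + ((\<Sum>x<q. g (q + x)) + (\<Sum>x<q. g (2 * q + x))))" by simp
    also have "(\<Sum>x<q. g x) + ((\<Sum>x<q. g (q + x)) + (\<Sum>x<q. g (2 * q + x))) = (\<Sum>b<3 * q. g b)"
    proof -
      have "(\<Sum>b<m + q. g b) = (\<Sum>b<m. g b) + (\<Sum>x<q. g (m + x))" for m
        by (induction q) (auto simp: add.assoc)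
      from this[of q] this[of "q + q"] show ?thesis by (simp add: mult_2 numeral_3_eq_3 add.assoc)
    qed
    finally show ?thesis .
  qed
  then show ?thesis using uni by (simp add: regular_def)
qed

text \<open>Writing \<^term>\<open>n\<close> for the number of vertices, the density of the pattern is
  \<^term>\<open>1/6 - 1 / (2 * n) + 1 / (3 * n\<^sup>2) - d / (3 * n\<^sup>2) :: real\<close>. The sizes below are chosen so
  that the increase in the second term is compensated exactly by an integral degree \<^term>\<open>d\<close>, and
  \<^term>\<open>s\<close> is large compared with \<^term>\<open>i\<close> so that \<^term>\<open>d\<close> is small compared with \<^term>\<open>n\<close>.\<close>

lemma pattern_circulant:
  assumes "1 \<le> i" "30 * i \<le> s"
  defines "q \<equiv> 2 * s * (s + i)" and "d \<equiv> 1 + 9 * i * (s + i)"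
  shows "pattern (1/6 - 1 / (12 * (real s)\<^sup>2)) (3 * q) (complete 3 {..<3 * q} - circulant d q)"
proof (rule pattern_complement)
  have s: "30 \<le> s" using assms(1,2) by linarith
  define a b where "a = i * (s + i)" and "b = s * (s + i)"
  have "30 * i * (s + i) \<le> s * (s + i)" using assms(2) by (rule mult_right_mono) simp
  then have "30 * a \<le> b" by (simp add: a_def b_def del: mult_le_cancel2)
  moreover have "1 * 31 \<le> i * (s + i)" using assms(1) s by (intro mult_mono) auto
  then have "31 \<le> a" by (simp add: a_def)
  moreover have "d = 1 + 9 * a" "q = 2 * b" by (simp_all add: d_def q_def a_def b_def)
  ultimately have le: "18 * d \<le> 3 * q" "d \<le> q" by linarith+
  show "regular d (3 * q) (circulant d q)" using le(2) by (rule regular_circulant)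
  show "18 * d \<le> 3 * q" by fact
  have "30 * 31 \<le> s * (s + i)" using assms(1) s by (intro mult_mono) auto
  then show "24 \<le> 3 * q" by (simp add: q_def mult.assoc)
  define r where "r = real s + real i"
  have r: "real (3 * q) = 6 * real s * r" "real d = 1 + 9 * real i * r" "real i = r - real s"
    by (auto simp: q_def d_def r_def algebra_simps)
  have "0 < r" "0 < real s" using s by (auto simp: r_def)
  then show "1/6 - 1 / (12 * (real s)\<^sup>2) =
      (1 - 3 / real (3 * q) + 2 / (real (3 * q))\<^sup>2) / 6 - real d / (3 * (real (3 * q))\<^sup>2)"
    unfolding r by (simp add: field_simps power2_eq_square)
qed

section \<open>The forbidden family and its extremal problem\<close>

lemma rgraph_uniform: "rgraph r H \<longleftrightarrow> uniform r (verts H) (edges H)"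
  by (simp add: rgraph_def uniform_def)

lemma subweight_uniform: "finite V \<Longrightarrow> card V = k \<Longrightarrow> 0 < k \<Longrightarrow> subweight V (\<lambda>_. 1 / real k)"
  by (simp add: subweight_def)

lemma wt_uniform: "uniform 3 V H \<Longrightarrow> wt H (\<lambda>_. 1 / real k) = real (card H) / real k ^ 3"
  using wt_const[of 3 V H "1 / real k"] by (simp add: power_divide)

context pattern_family
begin

definition pattern_graph :: "nat \<Rightarrow> nat hypergraph" where
  "pattern_graph i = \<lparr>verts = {..<n i}, edges = E i\<rparr>"

text \<open>The bound on the vertices is that of \<^term>\<open>locally_colourable\<close>, a property which avoiding this
  family thus implies.\<close>

definition forbidden :: "nat hypergraph set" where
  "forbidden = {F. verts F \<subseteq> {..<3 * (l + 1)\<^sup>2} \<and> rgraph 3 F \<and> (\<forall>i\<in>I. \<not> colorable (pattern_graph i) F)}"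

lemma finite_forbidden: "finite forbidden"
proof (rule finite_subset)
  let ?P = "Pow {..<3 * (l + 1)\<^sup>2}"
  show "forbidden \<subseteq> (\<lambda>(V, H). \<lparr>verts = V, edges = H\<rparr>) ` (?P \<times> Pow ?P)"
  proof
    fix F assume "F \<in> forbidden"
    then have "(verts F, edges F) \<in> ?P \<times> Pow ?P" by (auto simp: forbidden_def rgraph_def)
    moreover have "F = (\<lambda>(V, H). \<lparr>verts = V, edges = H\<rparr>) (verts F, edges F)" by simp
    ultimately show "F \<in> (\<lambda>(V, H). \<lparr>verts = V, edges = H\<rparr>) ` (?P \<times> Pow ?P)" by blast
  qed
qed simp

lemma colorable_iff_colouring:
  "colorable (pattern_graph i) H \<longleftrightarrow> (\<exists>c. colouring i (edges H) (verts H) c)" if "rgraph 3 H"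
  using that unfolding colorable_def colouring_def pattern_graph_def rgraph_def by fastforce

lemma free_if_colouring:
  assumes "i \<in> I" "colouring i (edges H) (verts H) c"
  shows "free forbidden H"
  unfolding free_def
proof (intro ballI notI)
  fix F assume F: "F \<in> forbidden" "contains H F"
  then obtain f where f: "f ` verts F \<subseteq> verts H" "\<forall>e\<in>edges F. f ` e \<in> edges H"
    by (auto simp: contains_def)
  have "colouring i (edges F) (verts F) (c \<circ> f)"
    unfolding colouring_def
  proof (intro conjI ballI impI)
    have "c ` f ` verts F \<subseteq> {..<n i}" using image_mono[OF f(1), of c] assms(2) unfolding colouring_def by blast
    then show "(c \<circ> f) ` verts F \<subseteq> {..<n i}" by (simp add: image_comp)
    fix e assume e: "e \<in> edges F" "e \<subseteq> verts F"
    then have "f ` e \<in> edges H" "f ` e \<subseteq> verts H" using f by auto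
    then have "c ` f ` e \<in> E i" using assms(2) unfolding colouring_def by blast
    then show "(c \<circ> f) ` e \<in> E i" by (simp add: image_comp)
  qed
  then show False using F(1) assms(1) colorable_iff_colouring[of F i] by (auto simp: forbidden_def)
qed

lemma free_imp_locally_colourable:
  assumes H: "rgraph 3 H" and free: "free forbidden H"
  shows "locally_colourable (verts H) (edges H)"
  unfolding locally_colourable_def
proof (intro conjI allI impI)
  show "uniform 3 (verts H) (edges H)" using H by (simp add: rgraph_uniform)
  fix X assume X: "X \<subseteq> verts H" "card X \<le> 3 * (l + 1)\<^sup>2"
  then have fX: "finite X" using H by (auto simp: rgraph_def intro: finite_subset)
  then obtain f where f: "bij_betw f X {0..<card X}" using ex_bij_betw_finite_nat by blast
  then have inj: "inj_on f X" and fXeq: "f ` X = {0..<card X}" by (auto simp: bij_betw_def)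
  define F where "F = \<lparr>verts = f ` X, edges = image f ` {e \<in> edges H. e \<subseteq> X}\<rparr>"
  have F: "rgraph 3 F" unfolding rgraph_def
  proof (intro conjI ballI)
    show "finite (verts F)" using fX by (simp add: F_def)
    fix e assume "e \<in> edges F"
    then obtain d where d: "d \<in> edges H" "d \<subseteq> X" "e = f ` d" by (auto simp: F_def)
    then show "e \<subseteq> verts F" by (auto simp: F_def)
    show "card e = 3" using d H inj_on_subset[OF inj d(2)] by (auto simp: card_image rgraph_def)
  qed
  have "contains H F"
    unfolding contains_def
  proof (intro exI[of _ "the_inv_into X f"] conjI ballI)
    show "inj_on (the_inv_into X f) (verts F)" using inj by (simp add: F_def inj_on_the_inv_into)
    show "the_inv_into X f ` verts F \<subseteq> verts H" using X inj by (simp add: F_def the_inv_into_onto)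
    fix e assume "e \<in> edges F"
    then obtain d where d: "d \<in> edges H" "d \<subseteq> X" "e = f ` d" by (auto simp: F_def)
    then have "the_inv_into X f ` e = (\<lambda>x. x) ` d"
      unfolding d(3) image_image using the_inv_into_f_f[OF inj] by (intro image_cong) auto
    then show "the_inv_into X f ` e \<in> edges H" using d by simp
  qed
  then have "F \<notin> forbidden" using free by (auto simp: free_def)
  moreover have "verts F \<subseteq> {..<3 * (l + 1)\<^sup>2}" using X(2) by (auto simp: F_def fXeq)
  ultimately obtain i c where i: "i \<in> I" and c: "colouring i (edges F) (verts F) c"
    using F colorable_iff_colouring[OF F] by (auto simp: forbidden_def)
  have "colouring i (edges H) X (c \<circ> f)"
    unfolding colouring_def
  proof (intro conjI ballI impI)
    show "(c \<circ> f) ` X \<subseteq> {..<n i}" using c by (auto simp: colouring_def F_def)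
    fix e assume e: "e \<in> edges H" "e \<subseteq> X"
    then have "f ` e \<in> edges F" "f ` e \<subseteq> verts F" by (auto simp: F_def)
    then have "c ` f ` e \<in> E i" using c unfolding colouring_def by blast
    then show "(c \<circ> f) ` e \<in> E i" by (simp add: image_comp)
  qed
  then show "\<exists>i\<in>I. \<exists>c. colouring i (edges H) X c" using i by blast
qed

lemma card_edges_le:
  assumes H: "rgraph 3 H" "card (verts H) = k" "0 < k" and free: "free forbidden H"
  shows "real (card (edges H)) \<le> lam * real k ^ 3"
proof -
  have "wt (edges H) (\<lambda>_. 1 / real k) \<le> lam"
    using free_imp_locally_colourable[OF H(1) free] H subweight_uniform[of "verts H" k]
    by (intro wt_le_lam) (auto simp: rgraph_def)
  then show ?thesis
    using wt_uniform[of "verts H" "edges H" k] H by (simp add: rgraph_uniform divide_le_eq)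
qed

lemma ex_num_bounds:
  fixes H :: "nat hypergraph"
  assumes "I \<noteq> {}"
  shows "0 < k \<Longrightarrow> real (ex_num 3 k forbidden) \<le> lam * real k ^ 3"
    and "rgraph 3 H \<Longrightarrow> card (verts H) = k \<Longrightarrow> free forbidden H \<Longrightarrow> card (edges H) \<le> ex_num 3 k forbidden"
proof -
  let ?S = "{card (edges H) | H :: nat hypergraph. rgraph 3 H \<and> card (verts H) = k \<and> free forbidden H}"
  have "card (edges H) \<le> 2 ^ k" if H: "rgraph 3 H" "card (verts H) = k" for H :: "nat hypergraph"
  proof -
    have "edges H \<subseteq> Pow (verts H)" "finite (verts H)" using H by (auto simp: rgraph_def)
    then show ?thesis using H(2) card_mono[of "Pow (verts H)" "edges H"] by (simp add: card_Pow)
  qed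
  then have fin: "finite ?S" by (intro finite_subset[of ?S "{..2 ^ k}"]) auto
  show "card (edges H) \<le> ex_num 3 k forbidden"
    if "rgraph 3 H" "card (verts H) = k" "free forbidden H"
    unfolding ex_num_def using that by (intro Max_ge[OF fin]) blast
  show "real (ex_num 3 k forbidden) \<le> lam * real k ^ 3" if k: "0 < k"
  proof -
    define H0 :: "nat hypergraph" where "H0 = \<lparr>verts = {..<k}, edges = {}\<rparr>"
    obtain i where i: "i \<in> I" using assms by blast
    have "colouring i (edges H0) (verts H0) (\<lambda>_. 0)"
      using patternD(2)[OF pat[OF i]] by (auto simp: colouring_def H0_def)
    then have "free forbidden H0" by (rule free_if_colouring[OF i])
    then have "card (edges H0) \<in> ?S" by (auto simp: H0_def rgraph_def intro!: exI[of _ H0])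
    then have "?S \<noteq> {}" by blast
    then have "ex_num 3 k forbidden \<in> ?S" unfolding ex_num_def by (intro Max_in fin)
    then obtain H :: "nat hypergraph" where "ex_num 3 k forbidden = card (edges H)"
        and H: "rgraph 3 H" "card (verts H) = k" "free forbidden H" by blast
    then show ?thesis using card_edges_le[OF H(1,2) k H(3)] by simp
  qed
qed

subsection \<open>Balanced blow-ups\<close>

lemma card_residue_class:
  assumes "b < m"
  shows "card (fibre (\<lambda>x. x mod m) {..<k} b) = (k + (m - 1 - b)) div m"
proof (induction k)
  case 0
  then show ?case using assms by (simp add: fibre_def)
next
  case (Suc k)
  have "fibre (\<lambda>x. x mod m) {..<Suc k} b =
      (if k mod m = b then insert k (fibre (\<lambda>x. x mod m) {..<k} b) else fibre (\<lambda>x. x mod m) {..<k} b)"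
    by (auto simp: fibre_def less_Suc_eq)
  then have "card (fibre (\<lambda>x. x mod m) {..<Suc k} b) = (k + (m - 1 - b)) div m + (if k mod m = b then 1 else 0)"
    using Suc by (simp add: fibre_def)
  moreover have "k mod m = b \<longleftrightarrow> m dvd Suc k + (m - 1 - b)"
  proof -
    have "Suc k + (m - 1 - b) = m * (k div m) + (k mod m + (m - b))"
      using assms by simp
    then have "m dvd Suc k + (m - 1 - b) \<longleftrightarrow> m dvd k mod m + (m - b)"
      by (metis dvd_add_right_iff dvd_triv_left)
    also have "\<dots> \<longleftrightarrow> k mod m + (m - b) = m"
    proof
      assume "m dvd k mod m + (m - b)"
      then obtain r where r: "k mod m + (m - b) = m * r" by blast
      have "k mod m < m" using assms by simp
      then have "0 < m * r" "m * r < m * 2" using r assms by linarith+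
      then have "r = 1" by simp
      then show "k mod m + (m - b) = m" using r by simp
    qed simp
    finally show ?thesis using assms by auto
  qed
  ultimately show ?case by (simp add: div_Suc dvd_eq_mod_eq_0)
qed

lemma residue_class_bounds:
  assumes "b < m"
  shows "real k / real m - 1 \<le> real (card (fibre (\<lambda>x. x mod m) {..<k} b))"
    and "real (card (fibre (\<lambda>x. x mod m) {..<k} b)) \<le> real k / real m + 1"
    and "m dvd k \<Longrightarrow> real (card (fibre (\<lambda>x. x mod m) {..<k} b)) = real k / real m"
proof -
  have m: "0 < m" using assms by simp
  define N where "N = (k + (m - 1 - b)) div m"
  note N = card_residue_class[OF assms, of k, folded N_def]
  have "m * N \<le> k + (m - 1 - b)" unfolding N_def by simp
  then have "m * N \<le> k + m" by linarith
  then have "real m * real N \<le> real k + real m" by (metis of_nat_add of_nat_le_iff of_nat_mult)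
  then show "real (card (fibre (\<lambda>x. x mod m) {..<k} b)) \<le> real k / real m + 1"
    unfolding N using m by (simp add: field_simps)
  have "k + (m - 1 - b) < m * N + m" unfolding N_def
    using m by (metis dividend_less_times_div add.commute mult.commute)
  then have "k \<le> m * N + m" using assms by linarith
  then have "real k \<le> real m * real N + real m" by (metis of_nat_add of_nat_le_iff of_nat_mult)
  then show "real k / real m - 1 \<le> real (card (fibre (\<lambda>x. x mod m) {..<k} b))"
    unfolding N using m by (simp add: field_simps)
  show "real (card (fibre (\<lambda>x. x mod m) {..<k} b)) = real k / real m" if "m dvd k"
  proof -
    from that obtain r where r: "k = m * r" by blast
    have "N = r" unfolding N_def r using assms by (intro div_nat_eqI) auto
    then show ?thesis unfolding N using r m by simp
  qed
qed

definition balanced :: "nat \<Rightarrow> nat \<Rightarrow> nat hypergraph" where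
  "balanced i k = \<lparr>verts = {..<k}, edges = blowup (\<lambda>x. x mod n i) {..<k} (E i)\<rparr>"

lemma balanced_simps [simp]:
  "verts (balanced i k) = {..<k}" "edges (balanced i k) = blowup (\<lambda>x. x mod n i) {..<k} (E i)"
  by (simp_all add: balanced_def)

lemma rgraph_balanced: "i \<in> I \<Longrightarrow> rgraph 3 (balanced i k)"
  unfolding rgraph_uniform balanced_simps by (rule uniform_blowup[OF patternD(1)[OF pat]]) auto

lemma free_balanced:
  assumes "i \<in> I"
  shows "free forbidden (balanced i k)"
proof (rule free_if_colouring[OF assms])
  have "0 < n i" using patternD(2)[OF pat[OF assms]] by simp
  then show "colouring i (edges (balanced i k)) (verts (balanced i k)) (\<lambda>x. x mod n i)"
    by (auto simp: colouring_def blowup_def)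
qed

text \<open>Larger classes only add edges to a blow-up, and with classes of equal size \<open>h / n i\<close> the number of
  edges would be \<open>lam * h ^ 3\<close>.\<close>

lemma card_balanced_ge:
  assumes i: "i \<in> I" and k: "0 < k" and h: "0 \<le> h" "\<And>b. b < n i \<Longrightarrow> h / real (n i) \<le> real (card (fibre (\<lambda>x. x mod n i) {..<k} b))"
  shows "real (card (edges (balanced i k))) \<ge> lam * h ^ 3"
proof -
  let ?c = "\<lambda>x. x mod n i"
  note uE = patternD(1)[OF pat[OF i]]
  have n0: "0 < real (n i)" using patternD(2)[OF pat[OF i]] by simp
  have "lam * h ^ 3 = real (card (E i)) * (h / real (n i)) ^ 3"
    using patternD(3)[OF pat[OF i]] n0 by (simp add: power_divide)
  also have "\<dots> = wt (E i) (\<lambda>_. h / real (n i))" by (rule wt_const[OF uE, symmetric])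
  also have "\<dots> \<le> wt (E i) (\<lambda>b. sum (\<lambda>_. 1) (fibre ?c {..<k} b))"
    unfolding wt_def using uniformD(3)[OF uE] h n0 by (intro sum_mono prod_mono) auto
  also have "\<dots> = wt (edges (balanced i k)) (\<lambda>_. 1)" unfolding balanced_simps by (rule wt_blowup[OF uE, symmetric]) simp
  also have "\<dots> = real (card (edges (balanced i k)))" by (simp add: wt_def)
  finally show ?thesis .
qed

lemma ex_num_ge:
  assumes i: "i \<in> I" and k: "n i < k"
  shows "real (ex_num 3 k forbidden) \<ge> lam * (real k - real (n i)) ^ 3"
proof -
  have n0: "0 < n i" using patternD(2)[OF pat[OF i]] by simp
  have "lam * (real k - real (n i)) ^ 3 \<le> real (card (edges (balanced i k)))"
  proof (rule card_balanced_ge[OF i])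
    fix b assume "b < n i"
    then show "(real k - real (n i)) / real (n i) \<le> real (card (fibre (\<lambda>x. x mod n i) {..<k} b))"
      using residue_class_bounds(1)[of b "n i" k] n0 by (simp add: diff_divide_distrib)
  qed (use k in auto)
  also have "\<dots> \<le> real (ex_num 3 k forbidden)"
    using ex_num_bounds(2)[of "balanced i k" k] rgraph_balanced[OF i] free_balanced[OF i] i by auto
  finally show ?thesis .
qed

lemma ex_num_eq:
  assumes i: "i \<in> I" and k: "0 < k" "n i dvd k"
  shows "real (ex_num 3 k forbidden) = lam * real k ^ 3"
    and "real (card (edges (balanced i k))) = lam * real k ^ 3"
proof -
  have "lam * real k ^ 3 \<le> real (card (edges (balanced i k)))"
    using k residue_class_bounds(3)[of _ "n i" k] by (intro card_balanced_ge[OF i]) auto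
  moreover have "card (edges (balanced i k)) \<le> ex_num 3 k forbidden"
    using ex_num_bounds(2)[of "balanced i k" k] rgraph_balanced[OF i] free_balanced[OF i] i by auto
  moreover have "real (ex_num 3 k forbidden) \<le> lam * real k ^ 3" using ex_num_bounds(1) i k by auto
  ultimately show "real (ex_num 3 k forbidden) = lam * real k ^ 3"
    "real (card (edges (balanced i k))) = lam * real k ^ 3" by linarith+
qed

subsection \<open>Stability\<close>

text \<open>Under the uniform weighting, the vertices outside the core are the few vertices of small degree.\<close>

lemma vertex_stability:
  assumes "\<delta> > 0"
  shows "\<exists>s>0. s \<le> \<delta> \<and> (\<forall>(H :: nat hypergraph) k. rgraph 3 H \<and> card (verts H) = k \<and> 0 < k \<and>
      free forbidden H \<and> real (card (edges H)) \<ge> (lam - s\<^sup>2) * real k ^ 3 \<longrightarrow>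
      (\<exists>i\<in>I. \<exists>R\<subseteq>verts H. real (card (verts H - R)) \<le> \<delta> * real k \<and> (\<exists>c. colouring i (edges H) R c)))"
proof -
  define s where "s = Min {\<theta>^3 / 30, \<delta> * \<theta> / 5, \<delta>}"
  have s: "0 < s" "s \<le> \<theta>^3 / 30" "s \<le> \<delta> * \<theta> / 5" "s \<le> \<delta>" using \<theta>(1) assms by (auto simp: s_def)
  have "\<theta>^3 \<le> 1^3" using \<theta>(1,2) by (intro power_mono) auto
  then have s4: "s \<le> 1/4" using s(2) by simp
  have "\<exists>i\<in>I. \<exists>R\<subseteq>verts H. real (card (verts H - R)) \<le> \<delta> * real k \<and> (\<exists>c. colouring i (edges H) R c)"
    if H: "rgraph 3 H" and k: "card (verts H) = k" "0 < k" and free: "free forbidden H"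
      and near: "real (card (edges H)) \<ge> (lam - s\<^sup>2) * real k ^ 3" for H :: "nat hypergraph" and k
  proof -
    let ?w = "\<lambda>_::nat. 1 / real k"
    note lc = free_imp_locally_colourable[OF H free]
    have fin: "finite (verts H)" using H by (simp add: rgraph_def)
    have w: "subweight (verts H) ?w" by (rule subweight_uniform[OF fin k])
    have wt: "wt (edges H) ?w = real (card (edges H)) / real k ^ 3"
      by (rule wt_uniform[OF H[unfolded rgraph_uniform]])
    have near1: "wt (edges H) ?w \<ge> lam - s\<^sup>2"
      unfolding wt using near k(2) by (simp add: le_divide_eq)
    moreover have "s\<^sup>2 \<le> (\<theta>^3 / 30)\<^sup>2" using s by (intro power_mono) auto
    ultimately have "wt (edges H) ?w \<ge> lam - (\<theta>^3 / 30)\<^sup>2" by linarith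
    then obtain i c where ic: "i \<in> I" "colouring i (edges H) (core (verts H) (edges H) ?w) c"
      using core_colourable[OF lc w] by blast
    let ?R = "core (verts H) (edges H) ?w"
    have "real (card (verts H - ?R)) / real k \<le> 5 * s / \<theta>"
      using core_weight[OF lc w near1 s(1) s4] by simp
    also have "\<dots> \<le> \<delta>" using s(3) \<theta>(1) by (simp add: field_simps)
    finally have "real (card (verts H - ?R)) \<le> \<delta> * real k" using k(2) by (simp add: divide_le_eq)
    moreover have "?R \<subseteq> verts H" by (auto simp: core_def)
    ultimately show ?thesis using ic by blast
  qed
  then show ?thesis using s(1,4) by (intro exI[of _ s]) blast
qed

lemma lam_pos:
  assumes i: "i \<in> I"
  shows "0 < lam"
proof -
  have "2 < n i" using patternD(2)[OF pat[OF i]] by simp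
  then obtain e where "e \<in> E i" using patternD(4)[OF pat[OF i], of 0 1] by auto
  then have "0 < card (E i)" using uniformD(2)[OF patternD(1)[OF pat[OF i]]] by (auto simp: card_gt_0_iff)
  then have "0 < lam * real (n i) ^ 3" using patternD(3)[OF pat[OF i]] by simp
  then show "0 < lam" using zero_less_mult_pos2[of lam "real (n i) ^ 3"] \<open>2 < n i\<close> by simp
qed

end

text \<open>Only surplus vertices of the classes on the left, counted by truncated subtraction, need to be
  misaligned.\<close>

lemma align_classes:
  assumes fin: "finite U" "finite V" and card: "card U = card V" and R: "R \<subseteq> V"
    and C: "finite C" "c ` U \<subseteq> C" "d ` R \<subseteq> C"
  obtains f W where "bij_betw f U V" "W \<subseteq> V" "\<And>x. x \<in> U \<Longrightarrow> f x \<notin> W \<Longrightarrow> f x \<in> R \<and> d (f x) = c x"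
    "card W = (\<Sum>b\<in>C. card (fibre c U b) - card (fibre d R b))"
proof -
  have fR: "finite R" using R fin(2) by (rule finite_subset)
  \<comment> \<open>Match as many vertices as possible within each class and the leftovers arbitrarily; \<open>W\<close> will be
    the set of images of leftovers.\<close>
  have "\<exists>A h. A \<subseteq> fibre c U b \<and> inj_on h A \<and> h ` A \<subseteq> fibre d R b \<and>
      card A = min (card (fibre c U b)) (card (fibre d R b))" for b
  proof -
    let ?m = "min (card (fibre c U b)) (card (fibre d R b))"
    obtain A where A: "A \<subseteq> fibre c U b" "card A = ?m" "finite A"
      using obtain_subset_with_card_n[of ?m "fibre c U b"] by auto
    have "card A \<le> card (fibre d R b)" using A by simp
    then obtain h where "h ` A \<subseteq> fibre d R b" "inj_on h A"
      using card_le_inj[of A "fibre d R b"] A(3) fR by auto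
    then show ?thesis using A by blast
  qed
  then obtain A h where A: "\<And>b. A b \<subseteq> fibre c U b" "\<And>b. inj_on (h b) (A b)" "\<And>b. h b ` A b \<subseteq> fibre d R b"
      "\<And>b. card (A b) = min (card (fibre c U b)) (card (fibre d R b))"
    by metis
  define D where "D = (\<Union>b\<in>C. A b)"
  define g where "g x = h (c x) x" for x
  have DU: "D \<subseteq> U" using A(1) by (auto simp: D_def fibre_def)
  have memD: "x \<in> A (c x)" if "x \<in> D" for x using that A(1) by (auto simp: D_def fibre_def)
  have gD: "g x \<in> R \<and> d (g x) = c x" if "x \<in> D" for x
  proof -
    have "h (c x) x \<in> fibre d R (c x)" using memD[OF that] A(3) by blast
    then show ?thesis by (simp add: fibre_def g_def)
  qed
  have inj: "inj_on g D"
  proof (rule inj_onI)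
    fix x y assume xy: "x \<in> D" "y \<in> D" "g x = g y"
    then have "c x = c y" using gD by metis
    moreover from this have "x \<in> A (c x)" "y \<in> A (c x)" using xy memD by metis+
    ultimately show "x = y" using xy inj_onD[OF A(2)[of "c x"]] by (simp add: g_def)
  qed
  have gDV: "g ` D \<subseteq> V" using gD R by auto
  have fD: "finite D" using DU fin(1) by (rule finite_subset)
  have "card (U - D) = card (V - g ` D)"
    using card_Diff_subset[OF fD DU] card_Diff_subset[OF finite_imageI[OF fD] gDV] card card_image[OF inj] by simp
  then obtain r where r: "bij_betw r (U - D) (V - g ` D)"
    using finite_same_card_bij[of "U - D" "V - g ` D"] fin by auto
  define f where "f x = (if x \<in> D then g x else r x)" for x
  have "bij_betw f D (g ` D)" using inj by (simp add: f_def bij_betw_def inj_on_def)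
  moreover have "bij_betw f (U - D) (V - g ` D)" using r by (subst bij_betw_cong[of _ f r]) (auto simp: f_def)
  ultimately have "bij_betw f (D \<union> (U - D)) (g ` D \<union> (V - g ` D))" by (rule bij_betw_combine) auto
  then have bij: "bij_betw f U V" using DU gDV by (simp add: Un_absorb1 Un_Diff_cancel)
  let ?W = "V - g ` D"
  have "f x \<in> R \<and> d (f x) = c x" if x: "x \<in> U" "f x \<notin> ?W" for x
  proof (cases "x \<in> D")
    case True
    then show ?thesis using gD by (simp add: f_def)
  next
    case False
    then have "f x \<in> ?W" using r x(1) by (auto simp: f_def bij_betw_def)
    then show ?thesis using x by simp
  qed
  moreover have "card ?W = (\<Sum>b\<in>C. card (fibre c U b) - card (fibre d R b))"
  proof -
    have fib: "finite (fibre c U b)" "finite (A b)" for b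
      using fin(1) A(1)[of b] by (auto intro: finite_subset)
    have "card ?W = card (U - D)" using r by (metis bij_betw_same_card)
    also have "U - D = (\<Union>b\<in>C. fibre c U b - A b)"
    proof
      show "U - D \<subseteq> (\<Union>b\<in>C. fibre c U b - A b)" using C(2) by (auto simp: D_def fibre_def)
      show "(\<Union>b\<in>C. fibre c U b - A b) \<subseteq> U - D" using memD by (auto simp: fibre_def)
    qed
    also have "card \<dots> = (\<Sum>b\<in>C. card (fibre c U b - A b))"
      using C(1) fib by (intro card_UN_disjoint) (auto simp: fibre_def)
    also have "\<dots> = (\<Sum>b\<in>C. card (fibre c U b) - card (fibre d R b))"
      using A(1,4) fib by (intro sum.cong) (auto simp: card_Diff_subset)
    finally show ?thesis .
  qed
  ultimately show thesis using that[OF bij, of ?W] by blast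
qed

lemma card_edges_meeting:
  assumes E: "uniform 3 V E" and k: "card V = k" "0 < k" and W: "W \<subseteq> V" and meet: "\<And>e. e \<in> E \<Longrightarrow> e \<inter> W \<noteq> {}"
  shows "real (card E) \<le> real (card W) * (real k)\<^sup>2"
proof -
  let ?w = "\<lambda>_. 1 / real k"
  have fV: "finite V" using E by (rule uniformD)
  have "wt E ?w \<le> wt {e \<in> E. e \<subseteq> V - W} ?w + sum ?w (V - (V - W))"
    using wt_restrict[of 2 V E ?w "V - W"] E subweight_uniform[OF fV k]
    by (simp add: numeral_3_eq_3)
  moreover have "{e \<in> E. e \<subseteq> V - W} = {}" using meet by blast
  moreover have "V - (V - W) = W" using W by blast
  ultimately have "real (card E) / real k ^ 3 \<le> real (card W) / real k"
    using wt_uniform[OF E, of k] by (simp add: wt_def)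
  then show ?thesis using k(2) by (simp add: field_simps power2_eq_square power3_eq_cube)
qed

context pattern_family
begin

text \<open>After aligning the colour classes with those of the balanced blow-up, an edge on which the two
  systems differ either meets a misaligned vertex or is one of the few edges which \<open>H\<close> lacks
  in the blow-up given by its colouring.\<close>

lemma edit_to_balanced:
  assumes H: "rgraph 3 H" and k: "card (verts H) = k" "0 < k" and i: "i \<in> I"
    and R: "R \<subseteq> verts H" and c: "colouring i (edges H) R c"
    and near: "real (card (edges H)) \<ge> (lam - s\<^sup>2) * real k ^ 3"
    and rest: "real (card (verts H - R)) \<le> \<rho> * real k" and small: "s\<^sup>2 + \<rho> \<le> \<tau>\<^sup>2" "0 \<le> \<tau>"
  shows "transformable ((real l * (5 * \<tau> + 1 / real k) + \<tau>\<^sup>2) * real k ^ 3) H (balanced i k)"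
proof -
  let ?V = "verts H" and ?w = "\<lambda>_. 1 / real k" and ?B = "blowup c R (E i)" and ?m = "\<lambda>x. x mod n i"
  have uH: "uniform 3 ?V (edges H)" using H by (simp add: rgraph_uniform)
  have fV: "finite ?V" using uH by (rule uniformD)
  have fR: "finite R" using R fV by (rule finite_subset)
  have near': "wt (edges H) ?w \<ge> lam - s\<^sup>2"
    unfolding wt_uniform[OF uH] using near k(2) by (simp add: le_divide_eq)
  have rest': "sum ?w (?V - R) \<le> \<rho>" using rest k(2) by (simp add: divide_le_eq)
  note ne = near_extremal_colouring[OF uH i subweight_uniform[OF fV k] R near' rest' small c]
  have ni: "0 < n i" using patternD(2)[OF pat[OF i]] by simp
  have cR: "c ` R \<subseteq> {..<n i}" using c by (simp add: colouring_def)
  have mU: "?m ` {..<k} \<subseteq> {..<n i}" using ni by auto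
  obtain f W where f: "bij_betw f {..<k} ?V" and W: "W \<subseteq> ?V"
      "\<And>x. x \<in> {..<k} \<Longrightarrow> f x \<notin> W \<Longrightarrow> f x \<in> R \<and> c (f x) = ?m x"
      "card W = (\<Sum>b\<in>{..<n i}. card (fibre ?m {..<k} b) - card (fibre c R b))"
    using align_classes[OF finite_lessThan fV _ R finite_lessThan mU cR] k(1) by auto
  have "real (card W) \<le> (\<Sum>b<n i. 5 * \<tau> * real k + 1)"
    unfolding W(3) of_nat_sum
  proof (rule sum_mono)
    fix b assume "b \<in> {..<n i}"
    then have b: "b < n i" by simp
    have "1 / real (n i) - 5 * \<tau> \<le> real (card (fibre c R b)) / real k"
      using ne(3)[OF b] by (simp add: abs_le_iff)
    then have "(1 / real (n i) - 5 * \<tau>) * real k \<le> real (card (fibre c R b))"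
      using k(2) by (simp add: le_divide_eq)
    then have lower: "real k / real (n i) - 5 * \<tau> * real k \<le> real (card (fibre c R b))"
      by (simp add: left_diff_distrib)
    have "0 \<le> 5 * \<tau> * real k" using small(2) by simp
    moreover have "real (a - b) \<le> max (real a - real b) 0" for a b :: nat by auto
    ultimately show "real (card (fibre ?m {..<k} b) - card (fibre c R b)) \<le> 5 * \<tau> * real k + 1"
      using residue_class_bounds(2)[OF b, of k] lower by (smt (verit))
  qed
  also have "\<dots> \<le> real l * (5 * \<tau> * real k + 1)"
    using n_le[OF i] small(2) by (simp add: mult_right_mono)
  finally have cardW: "real (card W) \<le> real l * (5 * \<tau> * real k + 1)" .
  define G' where "G' = \<lparr>verts = ?V, edges = (\<lambda>e. f ` e) ` edges (balanced i k)\<rparr>"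
  have "isomorphic (balanced i k) G'"
    unfolding isomorphic_def G'_def using f by (intro exI[of _ f]) simp
  moreover have "real (card (edges G' - edges H \<union> (edges H - edges G'))) \<le> (real l * (5 * \<tau> + 1 / real k) + \<tau>\<^sup>2) * real k ^ 3"
  proof -
    let ?D = "edges G' - edges H \<union> (edges H - edges G')"
    have injf: "inj_on f {..<k}" and imf: "f ` {..<k} = ?V" using f by (auto simp: bij_betw_def)
    have uG: "uniform 3 ?V (edges G')"
      unfolding uniform_def
    proof (intro conjI ballI)
      fix e assume "e \<in> edges G'"
      then obtain d where d: "d \<in> edges (balanced i k)" "e = f ` d" by (auto simp: G'_def)
      then have "d \<subseteq> {..<k}" "card d = 3" using rgraph_balanced[OF i, of k] by (auto simp: rgraph_def)
      then show "e \<subseteq> ?V" "card e = 3" using d(2) imf inj_on_subset[OF injf] by (auto simp: card_image)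
    qed (rule fV)
    have uD: "uniform 3 ?V ?D" using uH uG unfolding uniform_def by blast
    let ?M = "{e \<in> ?D. e \<inter> W \<noteq> {}}"
    have "?D - ?M \<subseteq> ?B - edges H"
    proof
      fix e assume e: "e \<in> ?D - ?M"
      then have eV: "e \<subseteq> ?V" and eW: "e \<inter> W = {}" using uniformD(3)[OF uD] by auto
      then obtain d where d: "d \<subseteq> {..<k}" "e = f ` d" using imf by (metis subset_imageE)
      have dR: "f x \<in> R \<and> c (f x) = ?m x" if "x \<in> d" for x
        using W(2)[of x] that d eW by blast
      then have eR: "e \<subseteq> R" using d(2) by auto
      have col: "c ` e = ?m ` d" using d(2) dR by (auto simp: image_image)
      have injd: "inj_on f d" using injf d(1) by (rule inj_on_subset)
      have inj: "inj_on c e \<longleftrightarrow> inj_on ?m d"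
        unfolding d(2) using comp_inj_on_iff[OF injd, of c] inj_on_cong[of d "c \<circ> f" ?m] dR by simp
      have eq: "e \<in> edges G' \<longleftrightarrow> e \<in> ?B"
      proof
        assume "e \<in> edges G'"
        then obtain d' where d': "d' \<in> edges (balanced i k)" "e = f ` d'" by (auto simp: G'_def)
        then have "d' \<subseteq> {..<k}" by (auto simp: blowup_def)
        then have "d' = d" using d'(2) d inj_on_image_eq_iff[OF injf] by metis
        then show "e \<in> ?B" using d' eR col inj by (auto simp: blowup_def)
      next
        assume "e \<in> ?B"
        then have "d \<in> edges (balanced i k)" using d(1) col inj by (auto simp: blowup_def)
        then show "e \<in> edges G'" using d(2) by (auto simp: G'_def)
      qed
      have "e \<in> ?B" if "e \<in> edges H" using edges_in_blowup[OF uH i c] that eR by blast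
      then show "e \<in> ?B - edges H" using e eq by blast
    qed
    moreover have fB: "finite ?B" using uniformD(2)[OF uniform_blowup[OF patternD(1)[OF pat[OF i]] fR]] .
    ultimately have "real (card (?D - ?M)) \<le> real (card (?B - edges H))" by (simp add: card_mono)
    also have "\<dots> \<le> \<tau>\<^sup>2 * real k ^ 3"
      using ne(1) wt_uniform[OF uniform_subset[OF uniform_blowup[OF patternD(1)[OF pat[OF i]] fR, of c], of "?B - edges H"], of k] k(2)
      by (simp add: divide_le_eq)
    finally have off: "real (card (?D - ?M)) \<le> \<tau>\<^sup>2 * real k ^ 3" .
    have "real (card ?M) \<le> real (card W) * (real k)\<^sup>2"
      by (rule card_edges_meeting[OF uniform_subset[OF uD] k W(1)]) auto
    also have "\<dots> \<le> real l * (5 * \<tau> * real k + 1) * (real k)\<^sup>2"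
      using cardW by (intro mult_right_mono) auto
    also have "\<dots> = real l * (5 * \<tau> + 1 / real k) * real k ^ 3"
      using k(2) by (simp add: field_simps power2_eq_square power3_eq_cube)
    finally have on: "real (card ?M) \<le> real l * (5 * \<tau> + 1 / real k) * real k ^ 3" .
    have "(?D - ?M) \<union> ?M = ?D" by blast
    then have "card ?D \<le> card (?D - ?M) + card ?M" using card_Un_le[of "?D - ?M" ?M] by simp
    then have "real (card ?D) \<le> real (card (?D - ?M)) + real (card ?M)"
      unfolding of_nat_add[symmetric] by (rule of_nat_mono)
    also have "\<dots> \<le> \<tau>\<^sup>2 * real k ^ 3 + real l * (5 * \<tau> + 1 / real k) * real k ^ 3"
      using off on by (rule add_mono)
    also have "\<dots> = (real l * (5 * \<tau> + 1 / real k) + \<tau>\<^sup>2) * real k ^ 3"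
      by (rule trans[OF add.commute distrib_right[symmetric]])
    finally show ?thesis .
  qed
  ultimately show ?thesis unfolding transformable_def by (intro exI[of _ G']) (simp add: G'_def)
qed

theorem balanced_stable:
  assumes I: "I = {1..t}" "I \<noteq> {}"
  shows "t_stable 3 forbidden t"
  unfolding t_stable_def
proof (intro exI[of _ balanced] conjI allI impI ballI)
  fix m i assume "i \<in> {1..t}"
  then show "rgraph 3 (balanced i m)" using rgraph_balanced I by simp
  show "card (verts (balanced i m)) = m" by simp
next
  fix \<delta> :: real assume \<delta>: "0 < \<delta>"
  obtain i0 where i0: "i0 \<in> I" using I(2) by blast
  have lam0: "0 < lam" by (rule lam_pos[OF i0])
  \<comment> \<open>The number of edits is at most \<open>(6 * l + 1) * \<tau> * k ^ 3\<close>, to be compared with \<open>\<delta>\<close> times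
    the at least \<open>lam / 2 * k ^ 3\<close> edges.\<close>
  define \<tau> where "\<tau> = Min {\<delta> * lam / (2 * (6 * real l + 1)), lam, 1}"
  have \<tau>: "0 < \<tau>" "\<tau> \<le> \<delta> * lam / (2 * (6 * real l + 1))" "\<tau> \<le> lam" "\<tau> \<le> 1"
    using \<delta> lam0 by (auto simp: \<tau>_def)
  have half: "0 < \<tau>\<^sup>2 / 2" using \<tau>(1) by simp
  obtain s where s: "0 < s" "s \<le> \<tau>\<^sup>2 / 2" and stab:
    "\<forall>(H :: nat hypergraph) k. rgraph 3 H \<and> card (verts H) = k \<and> 0 < k \<and> free forbidden H \<and>
      real (card (edges H)) \<ge> (lam - s\<^sup>2) * real k ^ 3 \<longrightarrow>
      (\<exists>i\<in>I. \<exists>R\<subseteq>verts H. real (card (verts H - R)) \<le> \<tau>\<^sup>2 / 2 * real k \<and> (\<exists>c. colouring i (edges H) R c))"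
    using vertex_stability[OF half] by blast
  have \<tau>2: "\<tau>\<^sup>2 \<le> \<tau>" using \<tau> by (simp add: power2_eq_square)
  have s2: "s\<^sup>2 \<le> \<tau>\<^sup>2 / 2"
  proof -
    have "s \<le> 1" using s(2) \<tau>2 \<tau>(4) by linarith
    then have "s\<^sup>2 \<le> s" using s(1) by (simp add: power2_eq_square)
    then show ?thesis using s(2) by linarith
  qed
  obtain k0 :: nat where k0: "real k0 \<ge> 1 / \<tau> + real l / s\<^sup>2 + real l + 1"
    using real_arch_simple by blast
  show "\<exists>\<epsilon>>0. \<exists>n0. \<forall>k\<ge>n0. \<forall>H :: nat hypergraph. rgraph 3 H \<and> card (verts H) = k \<and> free forbidden H \<and>
      (1 - \<epsilon>) * real (ex_num 3 k forbidden) < real (card (edges H)) \<longrightarrow>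
      (\<exists>i\<in>{1..t}. transformable (\<delta> * real (card (edges H))) H (balanced i k))"
  proof (intro exI[of _ "Min {s\<^sup>2, 1}"] conjI exI[of _ k0] allI impI)
    show "0 < Min {s\<^sup>2, 1}" using s(1) by simp
    fix k and H :: "nat hypergraph"
    assume k: "k0 \<le> k" and H: "rgraph 3 H \<and> card (verts H) = k \<and> free forbidden H \<and>
      (1 - Min {s\<^sup>2, 1}) * real (ex_num 3 k forbidden) < real (card (edges H))"
    let ?\<epsilon> = "Min {s\<^sup>2, 1 :: real}"
    have kk: "real k \<ge> 1 / \<tau> + real l / s\<^sup>2 + real l + 1" using k k0 by linarith
    have pos: "0 < 1 / \<tau>" "0 \<le> real l / s\<^sup>2" using \<tau> s by auto
    have kl: "real l + 1 \<le> real k" "1 / \<tau> \<le> real k" "real l / s\<^sup>2 \<le> real k"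
      using kk pos by linarith+
    have k1: "0 < real k" using kl by linarith
    have inv: "1 / real k \<le> \<tau>" "real l / real k \<le> s\<^sup>2"
      using kl(2,3) k1 \<tau>(1) s(1) by (auto simp: field_simps)
    have nl: "n i0 \<le> l" by (rule n_le[OF i0])
    have "(lam - s\<^sup>2) * real k ^ 3 \<le> lam * (1 - s\<^sup>2) * (1 - 3 * (real l / real k)) * real k ^ 3"
    proof (rule mult_right_mono)
      define x where "x = real l / real k"
      have x: "0 \<le> x" "x \<le> s\<^sup>2" using inv(2) by (simp_all add: x_def)
      have "lam * (1 - s\<^sup>2) * (1 - 3 * x) = lam - lam * s\<^sup>2 - lam * (3 * x) + lam * (s\<^sup>2 * (3 * x))"
        by (simp add: algebra_simps)
      moreover have "0 \<le> lam * (s\<^sup>2 * (3 * x))" using lam x by simp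
      moreover have "lam * s\<^sup>2 \<le> 1/6 * s\<^sup>2" using lam by (intro mult_right_mono) auto
      moreover have "lam * (3 * x) \<le> 1/6 * (3 * s\<^sup>2)" using lam x by (intro mult_mono) auto
      ultimately have "lam - s\<^sup>2 \<le> lam * (1 - s\<^sup>2) * (1 - 3 * x)"
        using zero_le_power2[of s] by linarith
      then show "lam - s\<^sup>2 \<le> lam * (1 - s\<^sup>2) * (1 - 3 * (real l / real k))" by (simp only: x_def)
    qed simp
    also have "\<dots> \<le> (1 - ?\<epsilon>) * (lam * (real k - real (n i0)) ^ 3)"
    proof -
      have x: "0 \<le> real l / real k" "real l / real k \<le> 1" using kl k1 by (auto simp: field_simps)
      have "1 - 3 * (real l / real k) \<le> (1 - real l / real k) ^ 3"
        using Bernoulli_inequality[of "- (real l / real k)" 3] x by simp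
      then have "(1 - 3 * (real l / real k)) * real k ^ 3 \<le> (1 - real l / real k) ^ 3 * real k ^ 3"
        by (intro mult_right_mono) auto
      also have "\<dots> = (real k - real l) ^ 3"
        using k1 by (simp add: power_mult_distrib[symmetric] left_diff_distrib)
      also have "\<dots> \<le> (real k - real (n i0)) ^ 3" using nl kl by (intro power_mono) auto
      finally have *: "(1 - 3 * (real l / real k)) * real k ^ 3 \<le> (real k - real (n i0)) ^ 3" .
      have s1: "s\<^sup>2 \<le> 1" using s2 \<tau>2 \<tau>(4) by linarith
      then have e: "?\<epsilon> = s\<^sup>2" by simp
      have "lam * (1 - s\<^sup>2) * ((1 - 3 * (real l / real k)) * real k ^ 3) \<le> lam * (1 - s\<^sup>2) * (real k - real (n i0)) ^ 3"
        using * lam s1 by (intro mult_left_mono) auto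
      then show ?thesis unfolding e by (simp only: mult.assoc mult.commute mult.left_commute)
    qed
    also have "\<dots> \<le> (1 - ?\<epsilon>) * real (ex_num 3 k forbidden)"
      using ex_num_ge[OF i0, of k] nl kl by (intro mult_left_mono) auto
    also have "\<dots> \<le> real (card (edges H))" using H by simp
    finally have near: "(lam - s\<^sup>2) * real k ^ 3 \<le> real (card (edges H))" .
    have kpos: "0 < k" using k1 by simp
    obtain i R c where i: "i \<in> I" and R: "R \<subseteq> verts H" "real (card (verts H - R)) \<le> \<tau>\<^sup>2 / 2 * real k"
        and c: "colouring i (edges H) R c"
      using stab H kpos near by blast
    have "transformable ((real l * (5 * \<tau> + 1 / real k) + \<tau>\<^sup>2) * real k ^ 3) H (balanced i k)"
      using edit_to_balanced[OF _ _ kpos i R(1) c near R(2)] H s2 \<tau>(1) by simp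
    moreover have "(real l * (5 * \<tau> + 1 / real k) + \<tau>\<^sup>2) * real k ^ 3 \<le> \<delta> * real (card (edges H))"
    proof -
      have "real l * (5 * \<tau> + 1 / real k) \<le> real l * (6 * \<tau>)" using inv(1) by (intro mult_left_mono) auto
      then have "real l * (5 * \<tau> + 1 / real k) + \<tau>\<^sup>2 \<le> (6 * real l + 1) * \<tau>" using \<tau>2 by (simp add: algebra_simps)
      also have "\<dots> \<le> \<delta> * (lam / 2)" using \<tau>(2) by (simp add: field_simps)
      also have "\<dots> \<le> \<delta> * (lam - s\<^sup>2)" using \<delta> s2 \<tau>2 \<tau>(3) by (intro mult_left_mono) auto
      finally have "(real l * (5 * \<tau> + 1 / real k) + \<tau>\<^sup>2) * real k ^ 3 \<le> \<delta> * (lam - s\<^sup>2) * real k ^ 3"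
        by (intro mult_right_mono) auto
      also have "\<dots> \<le> \<delta> * real (card (edges H))" using mult_left_mono[OF near, of \<delta>] \<delta> by (simp add: mult.assoc)
      finally show ?thesis .
    qed
    ultimately have "transformable (\<delta> * real (card (edges H))) H (balanced i k)"
      unfolding transformable_def by (meson order_trans)
    then show "\<exists>i\<in>{1..t}. transformable (\<delta> * real (card (edges H))) H (balanced i k)"
      using i I(1) by blast
  qed
qed

end

lemma transformableE:
  fixes H :: "'a hypergraph" and G :: "'b hypergraph"
  assumes "transformable K H G"
  obtains G' :: "'a hypergraph" and f where "verts G' = verts H" "bij_betw f (verts G) (verts G')"
    "edges G' = (\<lambda>e. f ` e) ` edges G"
    "real (card ((edges G' - edges H) \<union> (edges H - edges G'))) \<le> K"
  using assms unfolding transformable_def isomorphic_def by blast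

context pattern_family
begin

text \<open>If few edits turned the balanced blow-up of one pattern into that of another, some copy of the
  former pattern would survive in the latter blow-up and so be coloured by the latter pattern, which
  \<open>pattern_hom\<close> excludes for distinct patterns.\<close>

lemma balanced_far_apart:
  assumes ij: "i \<in> I" "j \<in> I" and k: "0 < k" and \<rho>: "bij_betw \<rho> {..<k} {..<k}"
    and dvd: "n j dvd k"
    and few: "real (card {e \<in> edges (balanced j k). \<rho> ` e \<notin> edges (balanced i k)}) < (1 / real l) ^ l * real k ^ 3"
  shows "i = j"
proof -
  let ?c = "\<lambda>x. x mod n j" and ?w = "\<lambda>_::nat. 1 / real k"
  let ?X = "{e \<in> edges (balanced j k). \<rho> ` e \<notin> edges (balanced i k)}"
  note uE = patternD(1)[OF pat[OF ij(2)]]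
  have nj: "0 < n j" and ni: "0 < n i" using patternD(2)[OF pat] ij by fastforce+
  have l: "0 < l" using l_pos[OF ij(1)] by simp
  have uX: "uniform 3 {..<k} ?X"
    using rgraph_balanced[OF ij(2), of k] unfolding rgraph_uniform balanced_simps(1)
    by (rule uniform_subset) blast
  have "wt ?X ?w < (1 / real l) ^ l"
    unfolding wt_uniform[OF uX] using few k by (simp add: divide_less_eq)
  also have "\<dots> \<le> (1 / real l) ^ n j" using n_le[OF ij(2)] l by (intro power_decreasing) auto
  also have "\<dots> \<le> (1 / real (n j)) ^ n j"
    using n_le[OF ij(2)] nj by (intro power_mono divide_left_mono) auto
  also have "\<dots> = (\<Prod>b<n j. sum ?w (fibre ?c {..<k} b))"
  proof -
    have "sum ?w (fibre ?c {..<k} b) = 1 / real (n j)" if "b < n j" for b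
      using residue_class_bounds(3)[OF that dvd] k by simp
    then show ?thesis by simp
  qed
  finally have "\<exists>A \<in> PiE {..<n j} (fibre ?c {..<k}). \<forall>e\<in>?X. \<exists>x\<in>e. A (?c x) \<noteq> x"
    using uniformD(2)[OF uX] nj subweight_uniform[of "{..<k}" k] k
    by (intro ex_transversal) (auto simp: blowup_def)
  then obtain A where A: "A \<in> PiE {..<n j} (fibre ?c {..<k})" and avoid: "\<forall>e\<in>?X. \<exists>x\<in>e. A (?c x) \<noteq> x"
    by (rule bexE)
  have Ak: "A b < k" and cA: "?c (A b) = b" if "b < n j" for b
    using A that by (auto simp: PiE_iff fibre_def)
  define \<psi> where "\<psi> b = \<rho> (A b) mod n i" for b
  have "\<psi> ` f \<in> E i" if f: "f \<in> E j" for f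
  proof -
    have fn: "\<And>b. b \<in> f \<Longrightarrow> b < n j" using uniformD(3)[OF uE f] by auto
    have "?c ` A ` f = (\<lambda>b. b) ` f" unfolding image_image using fn cA by (intro image_cong) auto
    moreover have "inj_on ?c (A ` f)" using fn cA by (intro inj_on_inverseI[where g = A]) auto
    ultimately have "A ` f \<in> edges (balanced j k)" using f fn Ak by (auto simp: blowup_def)
    moreover have "A ` f \<notin> ?X"
    proof
      assume "A ` f \<in> ?X"
      then have "\<exists>x\<in>A ` f. A (?c x) \<noteq> x" by (rule bspec[OF avoid])
      then show False using fn cA by auto
    qed
    ultimately have "\<rho> ` A ` f \<in> edges (balanced i k)" by blast
    then have "(\<lambda>x. x mod n i) ` \<rho> ` A ` f \<in> E i" by (simp add: blowup_def)
    then show ?thesis by (simp add: image_image \<psi>_def)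
  qed
  then have "n j = n i"
    using ni by (intro pattern_hom(2)[OF pat[OF ij(2)] pat[OF ij(1)], of \<psi>]) (auto simp: \<psi>_def)
  then show ?thesis using inj_n ij by (auto dest: inj_onD)
qed

text \<open>With fewer than \<open>t\<close> shapes, two balanced blow-ups with the same number of vertices are
  close to the same shape, hence to each other up to a relabelling of the vertices.\<close>

theorem not_stable_below:
  assumes I: "I = {1..t}" and st: "t_stable 3 forbidden s"
  shows "t \<le> s"
proof (rule ccontr)
  assume "\<not> t \<le> s"
  then have less: "s < t" by simp
  have i0: "1 \<in> I" using less I by simp
  have l: "0 < l" using l_pos[OF i0] by simp
  define \<delta> where "\<delta> = (1 / real l) ^ l"
  have \<delta>: "0 < \<delta>" using l by (simp add: \<delta>_def)
  obtain G :: "nat \<Rightarrow> nat \<Rightarrow> nat hypergraph" where G: "\<forall>m. \<forall>i\<in>{1..s}. rgraph 3 (G i m) \<and> card (verts (G i m)) = m"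
    and stab: "\<forall>\<delta>::real. \<delta> > 0 \<longrightarrow> (\<exists>\<epsilon>::real. \<epsilon> > 0 \<and> (\<exists>n0. \<forall>k\<ge>n0. \<forall>H :: nat hypergraph.
       rgraph 3 H \<and> card (verts H) = k \<and> free forbidden H \<and>
       real (card (edges H)) > (1 - \<epsilon>) * real (ex_num 3 k forbidden) \<longrightarrow>
       (\<exists>i\<in>{1..s}. transformable (\<delta> * real (card (edges H))) H (G i k))))"
    using st unfolding t_stable_def by blast
  obtain \<epsilon> :: real and n0 :: nat where \<epsilon>: "\<epsilon> > 0" and close: "\<forall>k\<ge>n0. \<forall>H :: nat hypergraph.
       rgraph 3 H \<and> card (verts H) = k \<and> free forbidden H \<and>
       real (card (edges H)) > (1 - \<epsilon>) * real (ex_num 3 k forbidden) \<longrightarrow>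
       (\<exists>i\<in>{1..s}. transformable (\<delta> * real (card (edges H))) H (G i k))"
    using stab[THEN spec, THEN mp, OF \<delta>] by blast
  \<comment> \<open>A common multiple of all sizes, so that all balanced blow-ups are extremal.\<close>
  define k where "k = (\<Prod>i\<in>I. n i) * Suc n0"
  have fI: "finite I" using I by simp
  have npos: "0 < n i" if "i \<in> I" for i using patternD(2)[OF pat[OF that]] by simp
  have dvd: "n i dvd k" if "i \<in> I" for i unfolding k_def using that fI by (intro dvd_mult2 dvd_prodI)
  have prodpos: "0 < (\<Prod>i\<in>I. n i)" using npos by (intro prod_pos) auto
  then have "1 * Suc n0 \<le> k" unfolding k_def by (intro mult_right_mono) auto
  then have k: "0 < k" "n0 \<le> k" by auto
  have cardB: "real (card (edges (balanced i k))) = lam * real k ^ 3"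
    and exB: "real (ex_num 3 k forbidden) = lam * real k ^ 3" if "i \<in> I" for i
    using ex_num_eq[OF that k(1) dvd[OF that]] by auto
  have pos: "0 < lam * real k ^ 3" using lam_pos[OF i0] k(1) by simp
  have "\<exists>r\<in>{1..s}. transformable (\<delta> * (lam * real k ^ 3)) (balanced i k) (G r k)" if i: "i \<in> I" for i
  proof -
    have "(1 - \<epsilon>) * (lam * real k ^ 3) < lam * real k ^ 3" using pos \<epsilon> by (simp add: algebra_simps)
    then show ?thesis
      using close[rule_format, OF k(2), of "balanced i k"] rgraph_balanced[OF i] free_balanced[OF i] cardB[OF i] exB[OF i] by simp
  qed
  then obtain r where r: "\<And>i. i \<in> I \<Longrightarrow> r i \<in> {1..s}"
      "\<And>i. i \<in> I \<Longrightarrow> transformable (\<delta> * (lam * real k ^ 3)) (balanced i k) (G (r i) k)"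
    by metis
  have "\<not> inj_on r I"
  proof
    assume "inj_on r I"
    then have "card I \<le> card {1..s}" using r(1) by (intro card_inj_on_le[of r]) auto
    then show False using I less by simp
  qed
  then obtain i j where ij: "i \<in> I" "j \<in> I" "i \<noteq> j" "r i = r j" by (auto simp: inj_on_def)
  define D where "D = G (r i) k"
  have D: "rgraph 3 D" using G r(1)[OF ij(1)] by (simp add: D_def)
  define K where "K = \<delta> * (lam * real k ^ 3)"
  obtain G1 :: "nat hypergraph" and f1 where G1': "verts G1 = verts (balanced i k)" "bij_betw f1 (verts D) (verts G1)"
    and G1: "edges G1 = (\<lambda>e. f1 ` e) ` edges D"
      "real (card ((edges G1 - edges (balanced i k)) \<union> (edges (balanced i k) - edges G1))) \<le> K"
    by (rule transformableE[OF r(2)[OF ij(1)], folded D_def K_def])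
  have bij1: "bij_betw f1 (verts D) {..<k}" using G1' by simp
  obtain G2 :: "nat hypergraph" and f2 where G2': "verts G2 = verts (balanced j k)" "bij_betw f2 (verts D) (verts G2)"
    and G2: "edges G2 = (\<lambda>e. f2 ` e) ` edges D"
      "real (card ((edges G2 - edges (balanced j k)) \<union> (edges (balanced j k) - edges G2))) \<le> K"
    by (rule transformableE[OF r(2)[OF ij(2)], folded ij(4), folded D_def K_def])
  have bij2: "bij_betw f2 (verts D) {..<k}" using G2' by simp
  define g where "g = the_inv_into (verts D) f2"
  define \<rho> where "\<rho> = f1 \<circ> g"
  have g: "bij_betw g {..<k} (verts D)" unfolding g_def by (rule bij_betw_the_inv_into[OF bij2])
  have \<rho>: "bij_betw \<rho> {..<k} {..<k}" unfolding \<rho>_def by (rule bij_betw_trans[OF g bij1])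
  have gf2: "g (f2 x) = x" if "x \<in> verts D" for x
    unfolding g_def using bij2 that by (intro the_inv_into_f_f) (auto simp: bij_betw_def)
  have \<rho>G: "\<rho> ` e \<in> edges G1" if e: "e \<in> edges G2" for e
  proof -
    obtain d where d: "d \<in> edges D" "e = f2 ` d" using e G2(1) by auto
    then have "d \<subseteq> verts D" using D by (auto simp: rgraph_def)
    then have "\<rho> ` e = f1 ` d" unfolding d(2) \<rho>_def image_image using gf2 by (intro image_cong) auto
    then show ?thesis using d(1) G1(1) by auto
  qed
  have finD: "finite (edges D)" using D uniformD(2) by (auto simp: rgraph_uniform)
  have finG: "finite (edges G1)" "finite (edges G2)" unfolding G1(1) G2(1) using finD by auto
  have finB: "finite (edges (balanced m k))" if "m \<in> I" for m
    using rgraph_balanced[OF that, of k] uniformD(2) unfolding rgraph_uniform by blast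
  let ?X = "{e \<in> edges (balanced j k). \<rho> ` e \<notin> edges (balanced i k)}"
  let ?Y = "{e \<in> edges G2. \<rho> ` e \<notin> edges (balanced i k)}"
  have "card ?X \<le> card ((edges (balanced j k) - edges G2) \<union> ?Y)"
    using finG finB[OF ij(2)] by (intro card_mono) auto
  also have "\<dots> \<le> card (edges (balanced j k) - edges G2) + card ?Y" by (rule card_Un_le)
  also have "card (edges (balanced j k) - edges G2) \<le> card ((edges G2 - edges (balanced j k)) \<union> (edges (balanced j k) - edges G2))"
    using finG finB[OF ij(2)] by (intro card_mono) auto
  also have "card ?Y \<le> card (edges G1 - edges (balanced i k))"
  proof (rule card_inj_on_le[of "image \<rho>"])
    have "e \<subseteq> {..<k}" if e: "e \<in> edges G2" for e
    proof -
      obtain d where d: "d \<in> edges D" "e = f2 ` d" using e G2(1) by auto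
      then have "d \<subseteq> verts D" using D by (auto simp: rgraph_def)
      then show ?thesis using d(2) bij2 by (auto simp: bij_betw_def)
    qed
    then show "inj_on (image \<rho>) ?Y"
      using \<rho> by (intro inj_on_subset[OF inj_on_image_Pow[of \<rho> "{..<k}"]]) (auto simp: bij_betw_def)
    show "image \<rho> ` ?Y \<subseteq> edges G1 - edges (balanced i k)" using \<rho>G by auto
    show "finite (edges G1 - edges (balanced i k))" using finG by simp
  qed
  also have "card (edges G1 - edges (balanced i k)) \<le> card ((edges G1 - edges (balanced i k)) \<union> (edges (balanced i k) - edges G1))"
    using finG finB[OF ij(1)] by (intro card_mono) auto
  finally have "card ?X \<le> card ((edges G2 - edges (balanced j k)) \<union> (edges (balanced j k) - edges G2))
      + card ((edges G1 - edges (balanced i k)) \<union> (edges (balanced i k) - edges G1))" by simp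
  then have "real (card ?X) \<le> K + K" using G1(2) G2(2) by linarith
  also have "K + K < \<delta> * real k ^ 3"
  proof -
    have "2 * lam * real k ^ 3 < 1 * real k ^ 3" using lam k(1) by (intro mult_strict_right_mono) auto
    then have "\<delta> * (2 * lam * real k ^ 3) < \<delta> * real k ^ 3" using \<delta> by simp
    then show ?thesis by (simp add: K_def)
  qed
  finally show False
    using balanced_far_apart[OF ij(1,2) k(1) \<rho> dvd[OF ij(2)]] ij(3) by (simp add: \<delta>_def)
qed

end

lemma ex_tolerance:
  fixes l :: nat
  assumes "1 \<le> l"
  obtains \<theta> :: real where "0 < \<theta>" "\<theta> \<le> 1/4" "10 * real l * \<theta> \<le> 1" "\<theta>\<^sup>2 + 12 * real l * \<theta> < (1 / (2 * real l)) ^ l"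
proof -
  define p where "p = (1 / (2 * real l)) ^ l"
  have p: "0 < p" "p \<le> 1" using assms by (auto simp: p_def intro!: power_le_one)
  \<comment> \<open>The left-hand side is at most \<open>13 * l * \<theta>\<close>, which this choice makes half of \<^term>\<open>p\<close>.\<close>
  define \<theta> where "\<theta> = p / (26 * real l)"
  have l\<theta>: "real l * \<theta> = p / 26" using assms by (simp add: \<theta>_def)
  have pos: "0 < \<theta>" using p assms by (simp add: \<theta>_def)
  have le: "\<theta> \<le> real l * \<theta>" using mult_right_mono[of 1 "real l" \<theta>] assms pos by simp
  show thesis
  proof (rule that[OF pos])
    show "\<theta> \<le> 1/4" "10 * real l * \<theta> \<le> 1" using le l\<theta> p by linarith+
    have "\<theta>\<^sup>2 \<le> \<theta>" using pos le l\<theta> p by (simp add: power2_eq_square)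
    then show "\<theta>\<^sup>2 + 12 * real l * \<theta> < (1 / (2 * real l)) ^ l"
      unfolding p_def[symmetric] using le l\<theta> p by linarith
  qed
qed

theorem theorem1p1:
  fixes t :: nat
  assumes "t \<ge> 1"
  shows "\<exists>(n :: nat \<Rightarrow> nat) (lam :: real) (G :: nat \<Rightarrow> nat hypergraph) (M :: nat hypergraph set).
    (\<forall>i\<in>{1..t}. 0 < n i) \<and> strict_mono_on {1..t} n \<and>
    0 < lam \<and> lam < 1 / 6 \<and>
    (\<forall>i\<in>{1..t}. rgraph 3 (G i) \<and> card (verts (G i)) = n i) \<and>
    finite M \<and> (\<forall>F\<in>M. rgraph 3 F) \<and>
    (\<forall>k::nat. k > 0 \<longrightarrow> real (ex_num 3 k M) \<le> lam * real k ^ 3) \<and>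
    (\<forall>k::nat. k > 0 \<and> (\<exists>i\<in>{1..t}. n i dvd k) \<longrightarrow> real (ex_num 3 k M) = lam * real k ^ 3) \<and>
    (\<forall>\<delta>::real. \<delta> > 0 \<longrightarrow>
       (\<exists>\<epsilon>::real. \<epsilon> > 0 \<and>
          (\<exists>N\<^sub>0. \<forall>k\<ge>N\<^sub>0. \<forall>H :: nat hypergraph.
             rgraph 3 H \<and> card (verts H) = k \<and> free M H \<and>
             real (card (edges H)) \<ge> (lam - \<epsilon>) * real k ^ 3 \<longrightarrow>
             (\<exists>i\<in>{1..t}. \<exists>S\<subseteq>verts H.
                real (card S) \<le> \<delta> * real k \<and> colorable (G i) (remove_verts H S))))) \<and>
    stability_number 3 M = enat t"
proof -
  define s where "s = 30 * t"
  define n where "n i = 3 * (2 * s * (s + i))" for i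
  define E where "E i = complete 3 {..<n i} - circulant (1 + 9 * i * (s + i)) (2 * s * (s + i))" for i
  define lam :: real where "lam = 1/6 - 1 / (12 * (real s)\<^sup>2)"
  have s: "30 \<le> s" using assms by (simp add: s_def)
  have mono: "strict_mono n" using s by (simp add: strict_mono_def n_def)
  have sq: "1 \<le> (real s)\<^sup>2" using s by (intro one_le_power) auto
  have "1 / (12 * (real s)\<^sup>2) \<le> 1 / 12" by (rule divide_left_mono) (use sq in linarith)+
  moreover have "0 < 1 / (12 * (real s)\<^sup>2)" using s by simp
  ultimately have lam: "0 < lam" "lam < 1/6" unfolding lam_def by linarith+
  have "1 \<le> n t" using s by (simp add: n_def)
  then obtain \<theta> :: real where \<theta>: "0 < \<theta>" "\<theta> \<le> 1/4" "10 * real (n t) * \<theta> \<le> 1"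
      "\<theta>\<^sup>2 + 12 * real (n t) * \<theta> < (1 / (2 * real (n t))) ^ n t"
    by (rule ex_tolerance)
  interpret pattern_family "{1..t}" n E lam "n t" \<theta>
  proof
    show "pattern lam (n i) (E i)" if "i \<in> {1..t}" for i
      using pattern_circulant[of i s] that by (simp add: lam_def n_def E_def s_def)
    show "inj_on n {1..t}" by (rule inj_on_subset[OF strict_mono_imp_inj_on[OF mono] subset_UNIV])
    show "n i \<le> n t" if "i \<in> {1..t}" for i using that mono by (simp add: strict_mono_less_eq)
  qed (use lam \<theta> in auto)
  have I: "{1..t} \<noteq> {}" using assms by simp
  have xi: "stability_number 3 forbidden = enat t"
    unfolding stability_number_def
  proof (rule antisym)
    show "Inf {enat t |t. t_stable 3 forbidden t} \<le> enat t"
      using balanced_stable[OF refl I] by (intro Inf_lower) auto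
    show "enat t \<le> Inf {enat t |t. t_stable 3 forbidden t}"
      using not_stable_below[OF refl] by (intro Inf_greatest) auto
  qed
  have stable: "\<exists>\<epsilon>>0. \<exists>N0. \<forall>k\<ge>N0. \<forall>H :: nat hypergraph.
      rgraph 3 H \<and> card (verts H) = k \<and> free forbidden H \<and> (lam - \<epsilon>) * real k ^ 3 \<le> real (card (edges H)) \<longrightarrow>
      (\<exists>i\<in>{1..t}. \<exists>S\<subseteq>verts H. real (card S) \<le> \<delta> * real k \<and> colorable (pattern_graph i) (remove_verts H S))"
    if \<delta>: "\<delta> > 0" for \<delta> :: real
  proof -
    obtain s where s: "0 < s" and stab:
      "\<forall>(H :: nat hypergraph) k. rgraph 3 H \<and> card (verts H) = k \<and> 0 < k \<and>
        free forbidden H \<and> real (card (edges H)) \<ge> (lam - s\<^sup>2) * real k ^ 3 \<longrightarrow>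
        (\<exists>i\<in>{1..t}. \<exists>R\<subseteq>verts H. real (card (verts H - R)) \<le> \<delta> * real k \<and> (\<exists>c. colouring i (edges H) R c))"
      using vertex_stability[OF \<delta>] by blast
    show ?thesis
    proof (intro exI[of _ "s\<^sup>2"] conjI exI[of _ "1::nat"] allI impI)
      show "0 < s\<^sup>2" using s by simp
      fix k :: nat and H :: "nat hypergraph"
      assume "1 \<le> k" and H: "rgraph 3 H \<and> card (verts H) = k \<and> free forbidden H \<and>
        (lam - s\<^sup>2) * real k ^ 3 \<le> real (card (edges H))"
      then have "0 < k" by simp
      then obtain i R c where i: "i \<in> {1..t}" and R: "R \<subseteq> verts H" "real (card (verts H - R)) \<le> \<delta> * real k"
          and c: "colouring i (edges H) R c"
        using stab H by blast
      let ?S = "verts H - R"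
      have "verts (remove_verts H ?S) = R" using R(1) by (auto simp: remove_verts_def)
      moreover have "edges (remove_verts H ?S) = {e \<in> edges H. e \<subseteq> R}"
        using H by (auto simp: remove_verts_def rgraph_def)
      ultimately have "rgraph 3 (remove_verts H ?S)" "colouring i (edges (remove_verts H ?S)) (verts (remove_verts H ?S)) c"
        using H R(1) c by (auto simp: rgraph_def colouring_def intro: finite_subset)
      then have "colorable (pattern_graph i) (remove_verts H ?S)" using colorable_iff_colouring by blast
      then show "\<exists>i\<in>{1..t}. \<exists>S\<subseteq>verts H. real (card S) \<le> \<delta> * real k \<and> colorable (pattern_graph i) (remove_verts H S)"
        using i R by (intro bexI[of _ i] exI[of _ ?S]) auto
    qed
  qed
  have graphs: "rgraph 3 (pattern_graph i) \<and> card (verts (pattern_graph i)) = n i" if "i \<in> {1..t}" for i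
    using patternD(1)[OF pat[OF that]] by (simp add: rgraph_uniform pattern_graph_def)
  show ?thesis
  proof (rule exI[of _ n], rule exI[of _ lam], rule exI[of _ pattern_graph], rule exI[of _ forbidden], intro conjI)
    show "\<forall>i\<in>{1..t}. 0 < n i" using s by (simp add: n_def)
    show "strict_mono_on {1..t} n" using mono by (simp add: strict_mono_on_def strict_monoD)
    show "0 < lam" "lam < 1/6" by fact+
    show "\<forall>i\<in>{1..t}. rgraph 3 (pattern_graph i) \<and> card (verts (pattern_graph i)) = n i"
      using graphs by blast
    show "finite forbidden" by (rule finite_forbidden)
    show "\<forall>F\<in>forbidden. rgraph 3 F" unfolding forbidden_def by blast
    show "\<forall>k>0. real (ex_num 3 k forbidden) \<le> lam * real k ^ 3" using ex_num_bounds(1)[OF I] by blast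
    show "\<forall>k. 0 < k \<and> (\<exists>i\<in>{1..t}. n i dvd k) \<longrightarrow> real (ex_num 3 k forbidden) = lam * real k ^ 3"
      using ex_num_eq(1) by blast
    show "stability_number 3 forbidden = enat t" by (rule xi)
  qed (intro allI impI, rule stable)
qed

end
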